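(* Let $n\ge 2$ and $r=2/(n-1)$. Consider the polynomial-case inner equation (P) and the trigonometric-case inner equation (T) (see context). 1. If $n$ is even, the equations (P) and (T) admit a unique formal solution $\tilde\phi$ such that: in the case of (P), $\tilde\phi\in\mathbb{C}[[z^{-r}],\{\mu\}]$ with $c_0^{n-1}=-r(r+1)$ (where $c_0$ is the coefficient of $z^{-r}$); and, in the case of (T), $\tilde\phi-\tilde\phi_0\in\mathbb{C}[[z^{-r}],\{\mu\}]$, with $$\tilde\phi_0(z)=\frac1{n-1}\log\left(-\frac{2}{n-1}\frac1{z^2}\right).$$ Moreover, any formal solution of (P) belonging to $\mathbb{C}[[z^{-r/2}],\{\mu\}]$ is of the form $\tilde\phi(z-c,\mu)$, for some $c\in\mathbb C$ and $c_0$ such that $c_0^{n-1}=-r(r+1)$. The same applies to any formal solution $\phi$ of (T) such that $\phi-\tilde\phi_0\in\mathbb{C}[[z^{-r/2}],\{\mu\}]$. 2. If $n=2m-1$ with $m\ge2$, the formal solutions are $$\tilde\phi(z,\mu)=\sum_{k\ge1}\frac1{z^{kr}}\sum_{0\le j\le\left[\frac{k-1}{m-1}\right]}c_{k-1,j}(\mu)\log^j z$$ in the case of (P), with $c_0=c_{0,0}$ satisfying $c_0^{n-1}=-r(r+1)$, and $$\tilde\phi(z,\mu)=\frac1{n-1}\log\left(-\frac2{n-1}\frac1{z^2}\right)+\sum_{k\ge1}\frac1{z^{kr}}\sum_{0\le j\le\left[\frac{k}{m-1}\right]}c_{k-1,j}(\mu)\log^j z$$ in the case of (T). The coefficients $c_{k-1,j}$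 are analytic functions in $B(\mu_0)$. The solution is unique provided that $c_{m-1,0}=0$. Any other formal solution of either of these two forms is obtained from these ones by translation.
   Context: Let $\Delta^2(\phi)(z)=\phi(z+1)-2\phi(z)+\phi(z-1)$; on formal series it acts as $\Delta^2=4\sinh^2\left(\frac12\partial_z\right)=\partial_z^2+\frac1{12}\partial_z^4+\cdots$. Let $B(\mu_0)$ be the open disc of radius $\mu_0$ centred at $0$ in $\mathbb C$, and let $G$ be analytic in the open bidisc $\{|y|<\varrho\}\times B(\mu_0)\subset\mathbb C^2$. The two inner equations are (P) polynomial case: $\Delta^2(\phi)=-\phi^n+G(\phi,\mu)$, with $G(y,\mu)=\sum_{k\ge n+1}G_k(\mu)y^k$; (T) trigonometric case: $\Delta^2(\phi)=-e^{(n-1)\phi}+G(e^{\phi},\mu)$, with $G(e^y,\mu)=\sum_{k\ge n}G_k(\mu)e^{ky}$. For $\nu>0$, $\mathbb{C}[[z^{-\nu}],\{\mu\}]$ is the space of formal power series $\sum_{k\ge1}c_{k-1}(\mu)z^{-\nu k}$ in $z^{-\nu}$ without constant term, whose coefficients $c_{k-1}$ depend analytically on $\mu\in B(\mu_0)$. The symbol $[x]$ stands for the integer part of $x$. Translation means replacing $z$ by $z-c$, $c\in\mathbb C$.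
   Formalization: In part 1 (P) the zero solution is excluded from the "moreover" claim; the translation constant c may depend analytically on μ; in part 2 for (T) the normalization is c_{m-2,0}=0 (coefficient of 1/z), since with c_{m-1,0}=0 uniqueness fails for G=0. *)

theory Defs
  imports
    "HOL-Complex_Analysis.Complex_Analysis"
    "HOL-Computational_Algebra.Computational_Algebra"
begin

text \<open>
  Formal series in \<open>z\<close> are elements of \<open>complex poly fps\<close>, relative to a number \<open>q \<ge> 1\<close>
  (always \<open>q = n - 1\<close> below): the power series variable stands for \<open>w = z\<^bsup>-1/q\<^esup>\<close> and the
  polynomial variable of the coefficients stands for \<open>log z\<close>.  Since \<open>r = 2/(n-1)\<close>, we have
  \<open>z\<^bsup>-r/2\<^esup> = w\<close>, \<open>z\<^bsup>-r\<^esup> = w\<^sup>2\<close> and \<open>z\<^bsup>-1\<^esup> = w\<^bsup>n-1\<^esup>\<close>; the coefficient of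
  \<open>z\<^bsup>-kr\<^esup> log\<^sup>j z\<close> in \<open>f\<close> is \<open>coeff (fps_nth f (2 * k)) j\<close>.  A series depending on
  \<open>\<mu>\<close> is a function \<open>complex \<Rightarrow> complex poly fps\<close>.
\<close>

type_synonym zseries = "complex poly fps"

text \<open>
  The derivation \<open>d/dz\<close>:  \<open>d/dz (w\<^sup>k p(log z)) = w\<^bsup>k+q\<^esup> (p'(log z) - (k/q) p(log z))\<close>.
\<close>

definition dz :: "nat \<Rightarrow> zseries \<Rightarrow> zseries" where
  "dz q f = Abs_fps (\<lambda>i. if i < q then 0
     else pderiv (fps_nth f (i - q)) - smult (of_nat (i - q) / of_nat q) (fps_nth f (i - q)))"

text \<open>
  \<open>translate q c f\<close> is \<open>f(z + c) = exp (c d/dz) f = (\<Sum>j. c\<^sup>j/j! (d/dz)\<^sup>j f)\<close>.  The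
  coefficient of \<open>w\<^sup>i\<close> in \<open>(d/dz)\<^sup>j f\<close> vanishes for \<open>j * q > i\<close>, so for \<open>q \<ge> 1\<close> the
  terms with \<open>j > i\<close> do not contribute to it.
\<close>

definition translate :: "nat \<Rightarrow> complex \<Rightarrow> zseries \<Rightarrow> zseries" where
  "translate q c f = Abs_fps (\<lambda>i. \<Sum>j\<le>i. smult (c ^ j / fact j) (fps_nth ((dz q ^^ j) f) i))"

definition delta2 :: "nat \<Rightarrow> zseries \<Rightarrow> zseries" where
  "delta2 q f = translate q 1 f - 2 * f + translate q (-1) f"

text \<open>\<open>delta2\<close> is \<open>4 sinh\<^sup>2 (1/2 d/dz) = (\<Sum>j\<ge>1. 2/(2j)! (d/dz)\<^bsup>2j\<^esup>)\<close>:\<close>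

lemma delta2_sinh:
  "fps_nth (delta2 q f) i =
     (\<Sum>j\<in>{1..i div 2}. smult (2 / fact (2 * j)) (fps_nth ((dz q ^^ (2 * j)) f) i))"
proof -
  define a where "a j = fps_nth ((dz q ^^ j) f) i" for j
  have "fps_nth (delta2 q f) i =
      (\<Sum>j\<le>i. smult (1 / fact j) (a j) + smult ((-1) ^ j / fact j) (a j)) - 2 * a 0"
    by (simp add: delta2_def translate_def a_def sum.distrib numeral_fps_const)
  also have "(\<Sum>j\<le>i. smult (1 / fact j) (a j) + smult ((-1) ^ j / fact j) (a j)) =
      (\<Sum>j\<in>{j. j \<le> i \<and> even j}. smult (2 / fact j) (a j))"
    by (rule sum.mono_neutral_cong_right)
      (auto simp flip: smult_add_left add_divide_distrib)
  also have "\<dots> = (\<Sum>j\<in>{0..i div 2}. smult (2 / fact (2 * j)) (a (2 * j)))"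
    by (rule sum.reindex_bij_witness[of _ "\<lambda>j. 2 * j" "\<lambda>j. j div 2"]) auto
  also have "\<dots> = 2 * a 0 + (\<Sum>j\<in>{1..i div 2}. smult (2 / fact (2 * j)) (a (2 * j)))"
    by (subst sum.atLeast_Suc_atMost) (simp_all add: numeral_poly)
  finally show ?thesis by (simp add: a_def)
qed

text \<open>
  Analyticity in two complex variables: local expansion in an absolutely convergent double
  power series.
\<close>

definition analytic2_on :: "(complex \<times> complex \<Rightarrow> complex) \<Rightarrow> (complex \<times> complex) set \<Rightarrow> bool" where
  "analytic2_on G U \<longleftrightarrow>
     (\<forall>y \<mu>. (y, \<mu>) \<in> U \<longrightarrow> (\<exists>a. \<exists>e>0. \<forall>h k. norm h < e \<longrightarrow> norm k < e \<longrightarrow>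
        ((\<lambda>(i, j). a i j * h ^ i * k ^ j) has_sum G (y + h, \<mu> + k)) UNIV))"

text \<open>\<open>G\<close> is analytic in the bidisc and \<open>G(y, \<mu>) = (\<Sum>k\<ge>N. g\<^sub>k(\<mu>) y\<^sup>k)\<close> there.\<close>

definition nonlinearity ::
  "nat \<Rightarrow> real \<Rightarrow> real \<Rightarrow> (complex \<times> complex \<Rightarrow> complex) \<Rightarrow> (nat \<Rightarrow> complex \<Rightarrow> complex) \<Rightarrow> bool" where
  "nonlinearity N \<rho> \<mu>0 G g \<longleftrightarrow>
     analytic2_on G (ball 0 \<rho> \<times> ball 0 \<mu>0) \<and>
     (\<forall>k<N. \<forall>\<mu>\<in>ball 0 \<mu>0. g k \<mu> = 0) \<and>
     (\<forall>y\<in>ball 0 \<rho>. \<forall>\<mu>\<in>ball 0 \<mu>0. (\<lambda>k. g k \<mu> * y ^ k) sums G (y, \<mu>))"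

text \<open>
  The series \<open>G(f, \<mu>) = (\<Sum>k. g\<^sub>k(\<mu>) f\<^sup>k)\<close>; as always for \<open>oo\<close>, it is meaningful for
  \<open>f\<close> without constant term.
\<close>

definition subst_G :: "(nat \<Rightarrow> complex \<Rightarrow> complex) \<Rightarrow> complex \<Rightarrow> zseries \<Rightarrow> zseries" where
  "subst_G g \<mu> f = Abs_fps (\<lambda>k. [:g k \<mu>:]) oo f"

definition solves_P ::
  "nat \<Rightarrow> real \<Rightarrow> (nat \<Rightarrow> complex \<Rightarrow> complex) \<Rightarrow> (complex \<Rightarrow> zseries) \<Rightarrow> bool" where
  "solves_P n \<mu>0 g \<phi> \<longleftrightarrow>
     (\<forall>\<mu>\<in>ball 0 \<mu>0. delta2 (n - 1) (\<phi> \<mu>) = - (\<phi> \<mu> ^ n) + subst_G g \<mu> (\<phi> \<mu>))"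

text \<open>
  \<open>\<phi>\<^sub>0(z) = 1/(n-1) log (- 2/(n-1) 1/z\<^sup>2) = (b - 2 log z)/(n-1)\<close>, where the number \<open>b\<close> with
  \<open>exp b = - 2/(n-1)\<close> encodes the branch of the logarithm.
\<close>

definition phi0 :: "nat \<Rightarrow> complex \<Rightarrow> zseries" where
  "phi0 n b = fps_const [:b / (of_nat n - 1), - 2 / (of_nat n - 1):]"

text \<open>
  \<open>exp f\<close> for a series \<open>f = \<phi>\<^sub>0 + \<psi>\<close> with \<open>\<psi>\<close> without constant term: here
  \<open>exp \<phi>\<^sub>0 = exp (b/(n-1)) z\<^bsup>-2/(n-1)\<^esup> = exp (b/(n-1)) w\<^sup>2\<close>.
\<close>

definition zexp :: "nat \<Rightarrow> complex \<Rightarrow> zseries \<Rightarrow> zseries" where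
  "zexp n b f = fps_const [:exp (b / (of_nat n - 1)):] * fps_X ^ 2 *
     (Abs_fps (\<lambda>k. [:1 / fact k:]) oo (f - phi0 n b))"

definition solves_T ::
  "nat \<Rightarrow> complex \<Rightarrow> real \<Rightarrow> (nat \<Rightarrow> complex \<Rightarrow> complex) \<Rightarrow> (complex \<Rightarrow> zseries) \<Rightarrow> bool" where
  "solves_T n b \<mu>0 g \<phi> \<longleftrightarrow>
     (\<forall>\<mu>\<in>ball 0 \<mu>0. delta2 (n - 1) (\<phi> \<mu>) =
        - (zexp n b (\<phi> \<mu>) ^ (n - 1)) + subst_G g \<mu> (zexp n b (\<phi> \<mu>)))"

text \<open>
  The series \<open>\<Sum>k\<ge>1. c\<^bsub>k-1\<^esub>(\<mu>) w\<^bsup>sk\<^esup>\<close> with \<open>c\<^sub>k\<close> analytic in the disc of radius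
  \<open>\<mu>0\<close>: \<open>s = 1\<close> gives the space for \<open>z\<^bsup>-r/2\<^esup>\<close> and \<open>s = 2\<close> that for \<open>z\<^bsup>-r\<^esup>\<close>.
\<close>

definition power_space :: "nat \<Rightarrow> real \<Rightarrow> (complex \<Rightarrow> zseries) set" where
  "power_space s \<mu>0 = {\<phi>. \<exists>c :: nat \<Rightarrow> complex \<Rightarrow> complex.
     (\<forall>k. c k analytic_on ball 0 \<mu>0) \<and>
     (\<forall>\<mu>\<in>ball 0 \<mu>0. \<phi> \<mu> =
        Abs_fps (\<lambda>i. if 0 < i \<and> s dvd i then [:c (i div s - 1) \<mu>:] else 0))}"

text \<open>
  The series \<open>\<Sum>k\<ge>1. z\<^bsup>-kr\<^esup> (\<Sum>j\<le>d(k). c\<^bsub>k-1,j\<^esub>(\<mu>) log\<^sup>j z)\<close> with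
  \<open>c\<^bsub>k,j\<^esub>\<close> analytic in the disc of radius \<open>\<mu>0\<close>.
\<close>

definition log_space :: "(nat \<Rightarrow> nat) \<Rightarrow> real \<Rightarrow> (complex \<Rightarrow> zseries) set" where
  "log_space d \<mu>0 = {\<phi>. \<exists>c :: nat \<Rightarrow> nat \<Rightarrow> complex \<Rightarrow> complex.
     (\<forall>k j. c k j analytic_on ball 0 \<mu>0) \<and>
     (\<forall>\<mu>\<in>ball 0 \<mu>0. \<phi> \<mu> =
        Abs_fps (\<lambda>i. if 0 < i \<and> 2 dvd i
          then (\<Sum>j\<le>d (i div 2). monom (c (i div 2 - 1) j \<mu>) j) else 0))}"

text \<open>
  \<open>c\<^bsub>k,j\<^esub>(\<mu>)\<close>, the coefficient of \<open>z\<^bsup>-(k+1)r\<^esup> log\<^sup>j z\<close> (note the index shift).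
\<close>

definition zcoeff :: "(complex \<Rightarrow> zseries) \<Rightarrow> nat \<Rightarrow> nat \<Rightarrow> complex \<Rightarrow> complex" where
  "zcoeff \<phi> k j \<mu> = coeff (fps_nth (\<phi> \<mu>) (2 * (k + 1))) j"

text \<open>
  Exactly one element up to values at parameters outside the disc, which carry no meaning.
\<close>

definition exactly_one :: "real \<Rightarrow> (complex \<Rightarrow> zseries) set \<Rightarrow> bool" where
  "exactly_one \<mu>0 S \<longleftrightarrow> (\<exists>\<phi>\<in>S. \<forall>\<psi>\<in>S. \<forall>\<mu>\<in>ball 0 \<mu>0. \<psi> \<mu> = \<phi> \<mu>)"

text \<open>
  \<open>\<phi>(z, \<mu>) = \<psi>(z - c, \<mu>)\<close>.  The constant \<open>c\<close> may depend (analytically) on the parameter: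
  if \<open>\<psi>(z, \<mu>)\<close> is a formal solution with analytic coefficients, so is \<open>\<psi>(z - \<mu>, \<mu>)\<close>.
\<close>

definition translate_of :: "nat \<Rightarrow> real \<Rightarrow> (complex \<Rightarrow> zseries) \<Rightarrow> (complex \<Rightarrow> zseries) \<Rightarrow> bool" where
  "translate_of n \<mu>0 \<phi> \<psi> \<longleftrightarrow> (\<exists>c. c analytic_on ball 0 \<mu>0 \<and>
     (\<forall>\<mu>\<in>ball 0 \<mu>0. \<phi> \<mu> = translate (n - 1) (- c \<mu>) (\<psi> \<mu>)))"

text \<open>
  The normalised formal solutions.  For odd \<open>n = 2m - 1\<close> the normalisation fixes the free
  (resonant) coefficient: that of \<open>z\<^bsup>-r-1\<^esup> = z\<^bsup>-mr\<^esup>\<close>, i.e. \<open>c\<^bsub>m-1,0\<^esub>\<close>, in the polynomial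
  case and that of \<open>z\<^bsup>-1\<^esup> = z\<^bsup>-(m-1)r\<^esup>\<close>, i.e. \<open>c\<^bsub>m-2,0\<^esub>\<close>, in the trigonometric case.
  In the latter case \<open>c\<^bsub>m-1,0\<^esub> = 0\<close> would not determine the solution: for \<open>G = 0\<close> and
  \<open>m \<ge> 3\<close> there are solutions with integer powers of \<open>z\<close> only, and all their translates
  have \<open>c\<^bsub>m-1,0\<^esub> = 0\<close>.
\<close>

definition P_even ::
  "nat \<Rightarrow> real \<Rightarrow> (nat \<Rightarrow> complex \<Rightarrow> complex) \<Rightarrow> complex \<Rightarrow> (complex \<Rightarrow> zseries) set" where
  "P_even n \<mu>0 g c0 = {\<phi> \<in> power_space 2 \<mu>0. solves_P n \<mu>0 g \<phi> \<and>
     (\<forall>\<mu>\<in>ball 0 \<mu>0. zcoeff \<phi> 0 0 \<mu> = c0)}"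

definition T_even ::
  "nat \<Rightarrow> real \<Rightarrow> (nat \<Rightarrow> complex \<Rightarrow> complex) \<Rightarrow> complex \<Rightarrow> (complex \<Rightarrow> zseries) set" where
  "T_even n \<mu>0 g b = {\<phi>. (\<lambda>\<mu>. \<phi> \<mu> - phi0 n b) \<in> power_space 2 \<mu>0 \<and> solves_T n b \<mu>0 g \<phi>}"

definition P_odd ::
  "nat \<Rightarrow> nat \<Rightarrow> real \<Rightarrow> (nat \<Rightarrow> complex \<Rightarrow> complex) \<Rightarrow> complex \<Rightarrow> (complex \<Rightarrow> zseries) set" where
  "P_odd n m \<mu>0 g c0 = {\<phi> \<in> log_space (\<lambda>k. (k - 1) div (m - 1)) \<mu>0. solves_P n \<mu>0 g \<phi> \<and>
     (\<forall>\<mu>\<in>ball 0 \<mu>0. zcoeff \<phi> 0 0 \<mu> = c0) \<and>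
     (\<forall>\<mu>\<in>ball 0 \<mu>0. zcoeff \<phi> (m - 1) 0 \<mu> = 0)}"

definition T_odd ::
  "nat \<Rightarrow> nat \<Rightarrow> real \<Rightarrow> (nat \<Rightarrow> complex \<Rightarrow> complex) \<Rightarrow> complex \<Rightarrow> (complex \<Rightarrow> zseries) set" where
  "T_odd n m \<mu>0 g b = {\<phi>. (\<lambda>\<mu>. \<phi> \<mu> - phi0 n b) \<in> log_space (\<lambda>k. k div (m - 1)) \<mu>0 \<and>
     solves_T n b \<mu>0 g \<phi> \<and>
     (\<forall>\<mu>\<in>ball 0 \<mu>0. zcoeff \<phi> (m - 2) 0 \<mu> = 0)}"

end

theory Submission
  imports Defs
begin

text \<open>
  Write \<open>q = n - 1\<close>, \<open>w = z\<^bsup>-1/q\<^esup>\<close> and \<open>\<phi> = w\<^sup>2 (c\<^sub>0 + u)\<close> for (P), \<open>\<phi> = \<phi>\<^sub>0 + u\<close>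
  for (T), where \<open>u\<close> has no constant term.  In both cases the coefficient \<open>u\<^sub>i\<close>, a polynomial in
  \<open>log z\<close>, is determined by its predecessors through an equation
  \<open>u\<^sub>i'' - a\<^sub>i u\<^sub>i' + b\<^sub>i u\<^sub>i = (lower terms)\<close> with \<open>a\<^sub>i \<noteq> 0\<close>, and \<open>b\<^sub>i = 0\<close> exactly for \<open>i = q\<close>:
  for (P), \<open>b\<^sub>i\<close> vanishes when \<open>s = (i + 2)/q\<close> satisfies \<open>s (s + 1) = n r (r + 1)\<close>, and for (T) when
  \<open>s = i/q\<close> satisfies \<open>s (s + 1) = 2\<close>.  Hence a solution is determined by the constant term of
  \<open>u\<^sub>q\<close>.  For odd \<open>q\<close> the normalised solution is even in \<open>w\<close> and never meets the resonance; for even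
  \<open>q\<close> the resonance creates one logarithm, and the power \<open>log\<^sup>j z\<close> appears only from
  \<open>w\<^bsup>qj\<^esup>\<close> on.  A translation \<open>z \<mapsto> z - c\<close> is a ring automorphism commuting with the equations, and it
  changes the constant term of \<open>u\<^sub>q\<close> by a non-zero multiple of \<open>c\<close>, so it produces all solutions.
\<close>

unbundle no vec_syntax

section \<open>Second order operators on polynomials\<close>

text \<open>The resonance is forced by translation invariance: d/dz of a solution is annihilated by
  the linearised equation, and its leading power, z^(-r-1) for (P) and z^(-1) for (T), sits in
  \<open>u\<close> at index \<open>q\<close>. The second root of the indicial quadratic is negative,
  so no other coefficient is free.

  The linear part of step i is the same for every \<mu>, since G enters only through terms already
  fixed. So analyticity in \<mu> can be recovered after a pointwise choice of coefficients: off
  resonance the preimage is unique, and its coefficients come from a finite recursion from the top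
  power of log z downwards.

  In (T) the series \<open>phi0\<close> has log z at order w^0, outside the filtration by powers of
  w. Its exponential is therefore split off in \<open>zexp\<close> as an explicit multiple of w^2,
  and the compatibility of this exponential with translations has to be proved; it follows from the
  linear equation y' = f' y.\<close>

lemma analytic_on_ball_cong:
  assumes "f analytic_on ball 0 R" "\<And>\<mu>. \<mu> \<in> ball 0 R \<Longrightarrow> f \<mu> = g \<mu>"
  shows "g analytic_on ball (0::complex) R"
  using assms holomorphic_transform[of f "ball 0 R" g] by (simp add: analytic_on_open)


text \<open>This is d^2/dz^2 in the variable x = log z: (z^(-s) p(x))'' = z^(-s-2) (p'' - (2s+1) p'
  + s(s+1) p). Keeping \<open>b\<close> free lets it absorb the linearised nonlinearity, which only
  multiplies p by a constant.\<close>

definition second_order_op :: "complex \<Rightarrow> complex \<Rightarrow> complex poly \<Rightarrow> complex poly" where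
  "second_order_op a b p = pderiv (pderiv p) - smult a (pderiv p) + smult b p"

lemma coeff_second_order_op:
  "coeff (second_order_op a b p) j =
     of_nat (j + 1) * of_nat (j + 2) * coeff p (j + 2) - a * of_nat (j + 1) * coeff p (j + 1) + b * coeff p j"
  by (simp add: second_order_op_def coeff_pderiv algebra_simps)

lemma second_order_op_add:
  "second_order_op a b (p + p') = second_order_op a b p + second_order_op a b p'"
  by (rule poly_eqI) (simp add: coeff_second_order_op algebra_simps)

lemma second_order_op_0 [simp]: "second_order_op a b 0 = 0"
  by (simp add: second_order_op_def)

lemma second_order_op_eq_0_nonresonant:
  assumes "second_order_op a b p = 0" "b \<noteq> 0"
  shows "p = 0"
proof (rule ccontr)
  assume "p \<noteq> 0"
  have "coeff (second_order_op a b p) (degree p) = b * lead_coeff p"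
    by (simp add: coeff_second_order_op coeff_eq_0)
  with assms \<open>p \<noteq> 0\<close> show False by simp
qed

text \<open>With b = 0 the operator lowers the degree of a nonconstant p by exactly one, so its
  kernel consists of the constants, which the condition on \<open>coeff p 0\<close>
  excludes.\<close>

lemma second_order_op_eq_0_resonant:
  assumes "second_order_op a 0 p = 0" "a \<noteq> 0" "coeff p 0 = 0"
  shows "p = 0"
proof (rule ccontr)
  assume nz: "p \<noteq> 0"
  have d: "degree p > 0"
    using assms(3) nz by (metis gr0I leading_coeff_0_iff)
  have "coeff (second_order_op a 0 p) (degree p - 1) = - a * of_nat (degree p) * lead_coeff p"
    using d by (simp add: coeff_second_order_op coeff_eq_0 of_nat_diff)
  with assms d nz show False by simp
qed

lemma second_order_op_surj:
  assumes "b \<noteq> 0"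
  obtains p where "second_order_op a b p = h"
proof -
  have "\<exists>p. second_order_op a b p = h"
  proof (induction "degree h" arbitrary: h rule: less_induct)
    case less
    \<comment> \<open>The error left by the approximate preimage h / b; it involves only derivatives
      of \<open>h\<close>, so the induction on the degree applies.\<close>
    define h' where "h' = h - second_order_op a b (smult (1 / b) h)"
    have h'_alt: "h' = smult (1 / b) (smult a (pderiv h) - pderiv (pderiv h))"
      using assms by (simp add: h'_def second_order_op_def pderiv_smult smult_diff_right algebra_simps)
    have "\<exists>p. second_order_op a b p = h'"
    proof (cases "degree h = 0")
      case True
      then have "pderiv h = 0" by (simp add: pderiv_eq_0_iff)
      then have "h' = 0" by (simp add: h'_alt)
      then show ?thesis by (intro exI[of _ 0]) simp
    next
      case False
      have "degree h' \<le> degree (smult a (pderiv h) - pderiv (pderiv h))"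
        by (simp add: h'_alt degree_smult_le)
      also have "\<dots> \<le> max (degree (pderiv h)) (degree (pderiv (pderiv h)))"
        by (rule order.trans[OF degree_diff_le_max]) (use degree_smult_le in \<open>auto simp: le_max_iff_disj\<close>)
      also have "\<dots> \<le> degree h - 1"
        by (simp add: degree_pderiv)
      finally show ?thesis using False less by simp
    qed
    then obtain p where "second_order_op a b p = h'" by blast
    then show ?case
      by (intro exI[of _ "smult (1 / b) h + p"]) (simp add: second_order_op_add h'_def)
  qed
  with that show thesis by blast
qed

lemma coeff_preimage_eq_0:
  assumes "second_order_op a b p = h" "b \<noteq> 0" "\<And>j. j > N \<Longrightarrow> coeff h j = 0" "j > N"
  shows "coeff p j = 0"
proof (rule ccontr)
  assume "coeff p j \<noteq> 0"
  then have "degree p \<ge> j" "p \<noteq> 0" by (auto simp: le_degree)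
  moreover have "coeff (second_order_op a b p) (degree p) = b * lead_coeff p"
    by (simp add: coeff_second_order_op coeff_eq_0)
  ultimately show False using assms by force
qed

text \<open>\<open>p\<close> is given separately at each \<mu>, yet b p_j is a linear expression in
  h_j, p_(j+1), p_(j+2). The bound \<open>N\<close>, uniform in \<mu>, gives this downward recursion
  a start.\<close>

lemma preimage_analytic:
  assumes eq: "\<And>\<mu>. \<mu> \<in> ball 0 R \<Longrightarrow> second_order_op a b (p \<mu>) = h \<mu>" and "b \<noteq> 0"
    and an: "\<And>j. (\<lambda>\<mu>. coeff (h \<mu>) j) analytic_on ball 0 R"
    and bound: "\<And>\<mu> j. \<mu> \<in> ball 0 R \<Longrightarrow> j > N \<Longrightarrow> coeff (h \<mu>) j = 0"
  shows "(\<lambda>\<mu>. coeff (p \<mu>) j) analytic_on ball 0 R"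
proof (induction "N + 1 - j" arbitrary: j rule: less_induct)
  case less
  show ?case
  proof (cases "j > N")
    case True
    have 0: "coeff (p \<mu>) j = 0" if "\<mu> \<in> ball 0 R" for \<mu>
      using coeff_preimage_eq_0[OF eq[OF that] \<open>b \<noteq> 0\<close> bound[OF that]] True by blast
    show ?thesis
      by (rule analytic_on_ball_cong[of "\<lambda>_. 0"]) (auto simp: 0)
  next
    case False
    have IH: "(\<lambda>\<mu>. coeff (p \<mu>) (j + 1)) analytic_on ball 0 R" "(\<lambda>\<mu>. coeff (p \<mu>) (j + 2)) analytic_on ball 0 R"
      by (rule less; use False in simp)+
    have pj: "coeff (p \<mu>) j = (coeff (h \<mu>) j - of_nat (j + 1) * of_nat (j + 2) * coeff (p \<mu>) (j + 2)
         + a * of_nat (j + 1) * coeff (p \<mu>) (j + 1)) / b" if "\<mu> \<in> ball 0 R" for \<mu>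
      using coeff_second_order_op[of a b "p \<mu>" j] eq[OF that] \<open>b \<noteq> 0\<close> by (simp add: field_simps)
    have an': "(\<lambda>\<mu>. (coeff (h \<mu>) j - of_nat (j + 1) * of_nat (j + 2) * coeff (p \<mu>) (j + 2)
         + a * of_nat (j + 1) * coeff (p \<mu>) (j + 1)) / b) analytic_on ball 0 R"
      using \<open>b \<noteq> 0\<close> by (intro analytic_intros an IH) auto
    show ?thesis
      by (rule analytic_on_ball_cong[OF an']) (simp only: pj)
  qed
qed

section \<open>The derivation and the translations\<close>

lemma smult_sum_right: "smult c (sum f A) = (\<Sum>x\<in>A. smult c (f x))"
  by (induction A rule: infinite_finite_induct) (simp_all add: smult_add_right)

lemma pderiv_sum: "pderiv (sum f A) = (\<Sum>x\<in>A. pderiv (f x))"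
  by (induction A rule: infinite_finite_induct) (simp_all add: pderiv_add)

section \<open>The derivation d/dz: product rule and orders in w\<close>

lemma dz_nth:
  "dz q f $ i = (if i < q then 0
     else pderiv (f $ (i - q)) - smult (of_nat (i - q) / of_nat q) (f $ (i - q)))"
  by (simp add: dz_def)

lemma dz_nth_eq_0 [simp]: "i < q \<Longrightarrow> dz q f $ i = 0"
  by (simp add: dz_def)

lemma dz_nth_add [simp]:
  "dz q f $ (i + q) = pderiv (f $ i) - smult (of_nat i / of_nat q) (f $ i)"
  by (simp add: dz_def)

lemma dz_eqI:
  assumes "\<And>i. i < q \<Longrightarrow> h $ i = 0"
    and "\<And>i. h $ (i + q) = pderiv (f $ i) - smult (of_nat i / of_nat q) (f $ i)"
  shows "dz q f = h"
proof (rule fps_ext)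
  fix i
  show "dz q f $ i = h $ i"
    using assms(1)[of i] assms(2)[of "i - q"] by (auto simp: dz_nth)
qed

lemma dz_add: "dz q (f + g) = dz q f + dz q g"
  by (rule dz_eqI) (simp_all add: pderiv_add smult_add_right)

lemma dz_diff: "dz q (f - g) = dz q f - dz q g"
  by (rule dz_eqI) (simp_all add: pderiv_diff smult_diff_right)

lemma dz_0 [simp]: "dz q 0 = 0"
  by (rule dz_eqI) simp_all

lemma dz_const_mult: "dz q (fps_const [:c:] * f) = fps_const [:c:] * dz q f"
  by (rule dz_eqI) (simp_all add: pderiv_smult smult_diff_right mult.commute)

lemma dz_sum: "dz q (sum f A) = (\<Sum>x\<in>A. dz q (f x))"
  by (induction A rule: infinite_finite_induct) (simp_all add: dz_add)

text \<open>Exhibits \<open>dz\<close> as w^q (d/dx - (1/q) w d/dw) with x = log z; the product rule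
  then reduces to those of \<open>pderiv\<close> and \<open>fps_deriv\<close>.\<close>

lemma dz_altdef:
  "dz q f = fps_X ^ q * (Abs_fps (\<lambda>i. pderiv (f $ i)) - fps_const [:1 / of_nat q:] * (fps_X * fps_deriv f))"
proof (rule dz_eqI)
  fix i
  have "of_nat i * f $ i = smult (of_nat i) (f $ i)"
    by (simp add: of_nat_poly)
  then have "(fps_X * fps_deriv f) $ i = smult (of_nat i) (f $ i)"
    by (cases i) simp_all
  then show "(fps_X ^ q * (Abs_fps (\<lambda>i. pderiv (f $ i)) - fps_const [:1 / of_nat q:] * (fps_X * fps_deriv f))) $ (i + q) =
         pderiv (f $ i) - smult (of_nat i / of_nat q) (f $ i)"
    by (simp add: fps_X_power_mult_nth)
qed (simp add: fps_X_power_mult_nth)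

lemma dz_mult: "dz q (f * g) = dz q f * g + f * dz q g"
proof -
  have "Abs_fps (\<lambda>i. pderiv ((f * g) $ i)) =
      Abs_fps (\<lambda>i. pderiv (f $ i)) * g + f * Abs_fps (\<lambda>i. pderiv (g $ i))"
    by (rule fps_ext, simp only: fps_nth_Abs_fps fps_add_nth fps_mult_nth pderiv_sum pderiv_mult sum.distrib)
      (simp add: mult.commute add.commute)
  then show ?thesis
    by (simp add: dz_altdef algebra_simps)
qed

lemma dz_const [simp]: "dz q (fps_const [:c:]) = 0"
  by (rule dz_eqI) (auto simp: fps_const_def)

lemma dz_power: "dz q (f ^ Suc k) = fps_const [:of_nat (Suc k):] * f ^ k * dz q f"
proof (induction k)
  case (Suc k)
  have "dz q (f ^ Suc (Suc k)) = (fps_const [:1:] + fps_const [:of_nat (Suc k):]) * f ^ Suc k * dz q f"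
    by (subst power_Suc, subst dz_mult, subst Suc) (simp add: algebra_simps flip: one_pCons)
  also have "fps_const [:1:] + fps_const [:of_nat (Suc k):] = fps_const [:of_nat (Suc (Suc k)) :: complex:]"
    by (simp only: fps_const_add) simp
  finally show ?case .
qed (simp flip: one_pCons)

lemma dz_funpow_nth_eq_0:
  assumes "\<And>j. j < t \<Longrightarrow> f $ j = 0" "i < t + k * q"
  shows "(dz q ^^ k) f $ i = 0"
  using assms(2)
proof (induction k arbitrary: i)
  case (Suc k)
  show ?case
  proof (cases "i < q")
    case False
    then have "(dz q ^^ k) f $ (i - q) = 0"
      using Suc.prems by (intro Suc.IH) auto
    with False show ?thesis by (simp add: dz_nth)
  qed simp
qed (use assms in auto)

lemma dz_funpow_nth_eq_0': "i < k * q \<Longrightarrow> (dz q ^^ k) f $ i = 0"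
  by (rule dz_funpow_nth_eq_0[where t = 0]) auto

lemma dz_funpow_nth_cong:
  assumes "\<And>j. j \<le> N \<Longrightarrow> f $ j = g $ j" "i \<le> N"
  shows "(dz q ^^ k) f $ i = (dz q ^^ k) g $ i"
  using assms(2) by (induction k arbitrary: i) (use assms in \<open>auto simp: dz_nth\<close>)

lemma dz_funpow_diff: "(dz q ^^ k) (f - g) = (dz q ^^ k) f - (dz q ^^ k) g"
  by (induction k) (simp_all add: dz_diff)

lemma dz_funpow_add: "(dz q ^^ k) (f + g) = (dz q ^^ k) f + (dz q ^^ k) g"
  by (induction k) (simp_all add: dz_add)

lemma dz_funpow_const_mult: "(dz q ^^ k) (fps_const [:c:] * f) = fps_const [:c:] * (dz q ^^ k) f"
  by (induction k) (simp_all add: dz_const_mult)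

section \<open>The second difference at leading order\<close>

lemma delta2_diff: "delta2 q (f - g) = delta2 q f - delta2 q g"
  by (rule fps_ext) (simp add: delta2_sinh dz_funpow_diff smult_diff_right sum_subtractf)

lemma delta2_add: "delta2 q (f + g) = delta2 q f + delta2 q g"
  by (rule fps_ext) (simp add: delta2_sinh dz_funpow_add smult_add_right sum.distrib)

lemma delta2_nth_eq_0:
  assumes "\<And>j. j < t \<Longrightarrow> f $ j = 0" "i < t + 2 * q"
  shows "delta2 q f $ i = 0"
proof -
  have "(dz q ^^ (2 * j)) f $ i = 0" if "j \<ge> 1" for j
  proof (rule dz_funpow_nth_eq_0[OF assms(1)])
    have "2 * q \<le> 2 * j * q" using that by simp
    with assms(2) show "i < t + 2 * j * q" by linarith
  qed
  then show ?thesis by (simp add: delta2_sinh)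
qed

text \<open>The j-th term of the sinh series raises the order by 2jq, so at w^(t+2q) only the second
  derivative is seen, with s = t/q.\<close>

lemma delta2_nth_leading:
  assumes "\<And>j. j < t \<Longrightarrow> f $ j = 0" "q \<ge> 1"
  shows "delta2 q f $ (t + 2 * q) =
    second_order_op (2 * of_nat t / of_nat q + 1) (of_nat t / of_nat q * (of_nat t / of_nat q + 1)) (f $ t)"
proof -
  have 0: "(dz q ^^ (2 * j)) f $ (t + 2 * q) = 0" if "j \<noteq> 1" "j \<ge> 1" for j
  proof (rule dz_funpow_nth_eq_0[OF assms(1)])
    have "2 * q < 2 * j * q" using that assms(2) by simp
    then show "t + 2 * q < t + 2 * j * q" by linarith
  qed
  have "delta2 q f $ (t + 2 * q) = (\<Sum>j\<in>{1..(t + 2 * q) div 2}. if j = 1 then (dz q ^^ 2) f $ (t + 2 * q) else 0)"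
    unfolding delta2_sinh by (intro sum.cong) (use 0 in auto)
  also have "\<dots> = (dz q ^^ 2) f $ (t + 2 * q)"
    using assms(2) by simp
  also have "\<dots> = dz q (dz q f) $ (t + q + q)"
    by (simp add: numeral_2_eq_2 add.assoc mult_2)
  also have "\<dots> = second_order_op (2 * of_nat t / of_nat q + 1) (of_nat t / of_nat q * (of_nat t / of_nat q + 1)) (f $ t)"
    unfolding dz_nth_add using assms(2)
    by (intro poly_eqI) (simp add: second_order_op_def pderiv_diff pderiv_smult field_simps)
  finally show ?thesis .
qed

section \<open>Translation as the exponential of a derivation\<close>

definition taylor_term :: "nat \<Rightarrow> complex \<Rightarrow> nat \<Rightarrow> zseries \<Rightarrow> zseries" where
  "taylor_term q c k f = fps_const [:c ^ k / fact k:] * (dz q ^^ k) f"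

lemma taylor_term_nth_eq_0: "i < k * q \<Longrightarrow> taylor_term q c k f $ i = 0"
  by (simp add: taylor_term_def dz_funpow_nth_eq_0')

text \<open>The sum defining \<open>translate\<close> is cut off at i, differently for each
  coefficient. One common cut-off N >= i gives a finite sum of series, to which ring operations
  apply; the additional terms have order above i because q >= 1.\<close>

lemma translate_nth:
  assumes "q \<ge> 1" "i \<le> N"
  shows "translate q c f $ i = (\<Sum>k\<le>N. taylor_term q c k f) $ i"
proof -
  have "(\<Sum>k\<le>N. taylor_term q c k f) $ i = (\<Sum>k\<le>N. taylor_term q c k f $ i)"
    by (simp add: fps_sum_nth)
  also have "\<dots> = (\<Sum>k\<le>i. taylor_term q c k f $ i)"
  proof (rule sum.mono_neutral_right)
    show "\<forall>k\<in>{..N} - {..i}. taylor_term q c k f $ i = 0"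
    proof
      fix k assume "k \<in> {..N} - {..i}"
      then have "i < k" by auto
      also have "k \<le> k * q" using assms by simp
      finally show "taylor_term q c k f $ i = 0" by (rule taylor_term_nth_eq_0)
    qed
  qed (use assms in auto)
  finally show ?thesis by (simp add: translate_def taylor_term_def)
qed

text \<open>Division-free form of the flow equation dF/dt = c dF/dz for F = exp(t c d/dz) f.\<close>

lemma taylor_term_Suc:
  "of_nat (Suc k) * taylor_term q c (Suc k) f = fps_const [:c:] * dz q (taylor_term q c k f)"
proof -
  have "of_nat (Suc k) * fps_const [:c ^ Suc k / fact (Suc k):] = fps_const [:c:] * fps_const [:c ^ k / fact k:]"
    by (simp add: fps_of_nat[symmetric] of_nat_poly field_simps del: fps_of_nat of_nat_Suc)
  then show ?thesis
    unfolding taylor_term_def dz_const_mult by (metis (no_types, lifting) funpow.simps(2) mult.assoc o_apply)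
qed

text \<open>The Leibniz formula without binomial coefficients: collect the Taylor terms into series
  in a formal time. The product of the two series obeys the same first order recursion as the series
  of \<open>f * g\<close>, because \<open>dz\<close> is a derivation.\<close>

lemma taylor_term_mult:
  "taylor_term q c k (f * g) = (\<Sum>i\<le>k. taylor_term q c i f * taylor_term q c (k - i) g)"
proof -
  define F where "F = Abs_fps (\<lambda>k. taylor_term q c k f)"
  define G where "G = Abs_fps (\<lambda>k. taylor_term q c k g)"
  have dF: "fps_deriv F $ k = fps_const [:c:] * dz q (F $ k)" for k
    using taylor_term_Suc[of k q c f] by (simp add: F_def)
  have dG: "fps_deriv G $ k = fps_const [:c:] * dz q (G $ k)" for k
    using taylor_term_Suc[of k q c g] by (simp add: G_def)
  have "taylor_term q c k (f * g) = (F * G) $ k"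
  proof (induction k)
    case 0
    show ?case by (simp add: F_def G_def taylor_term_def flip: one_pCons)
  next
    case (Suc k)
    have "of_nat (Suc k) * (F * G) $ Suc k = fps_deriv (F * G) $ k"
      by (simp only: fps_deriv_nth Suc_eq_plus1)
    also have "\<dots> = (\<Sum>i=0..k. fps_const [:c:] * dz q (F $ i * G $ (k - i)))"
      unfolding fps_deriv_mult fps_add_nth fps_mult_nth sum.distrib[symmetric] dF dG
      by (intro sum.cong refl) (simp only: dz_mult algebra_simps)
    also have "\<dots> = fps_const [:c:] * dz q ((F * G) $ k)"
      by (simp only: fps_mult_nth dz_sum sum_distrib_left)
    also have "\<dots> = of_nat (Suc k) * taylor_term q c (Suc k) (f * g)"
      by (simp only: taylor_term_Suc Suc)
    finally show ?case
      by (metis mult_left_cancel of_nat_neq_0)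
  qed
  then show ?thesis by (simp add: F_def G_def fps_mult_nth atLeast0AtMost)
qed

lemma fps_mult_nth_cong:
  assumes "\<And>j. j \<le> i \<Longrightarrow> f $ j = f' $ j" "\<And>j. j \<le> i \<Longrightarrow> g $ j = g' $ j"
  shows "(f * g) $ i = (f' * g') $ i"
  unfolding fps_mult_nth by (intro sum.cong refl) (simp add: assms)

lemma translate_mult:
  assumes "q \<ge> 1"
  shows "translate q c (f * g) = translate q c f * translate q c g"
proof (rule fps_ext)
  fix i
  let ?t = "\<lambda>a b. (taylor_term q c a f * taylor_term q c b g) $ i"
  have 0: "?t a b = 0" if "i < a + b" for a b
    unfolding fps_mult_nth
  proof (intro sum.neutral ballI)
    fix j assume j: "j \<in> {0..i}"
    have "i < (a + b) * q" using that assms by (metis less_le_trans mult_le_mono2 mult_1_right)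
    then have "j < a * q \<or> i - j < b * q" using j by (auto simp: algebra_simps)
    then show "taylor_term q c a f $ j * taylor_term q c b g $ (i - j) = 0"
      by (auto simp: taylor_term_nth_eq_0)
  qed
  have "translate q c (f * g) $ i = (\<Sum>k\<le>i. \<Sum>a\<le>k. ?t a (k - a))"
    by (simp add: translate_nth[OF assms order_refl] taylor_term_mult fps_sum_nth)
  also have "\<dots> = (\<Sum>(a, b)\<in>{(a, b). a + b \<le> i}. ?t a b)"
    by (rule sum.triangle_reindex_eq[symmetric])
  \<comment> \<open>Enlarging the triangle to the square is harmless: a term with a + b > i has
    order at least (a + b) q > i.\<close>
  also have "\<dots> = (\<Sum>(a, b)\<in>{..i} \<times> {..i}. ?t a b)"
    by (rule sum.mono_neutral_left) (auto intro!: 0)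
  also have "\<dots> = ((\<Sum>a\<le>i. taylor_term q c a f) * (\<Sum>b\<le>i. taylor_term q c b g)) $ i"
    by (simp add: sum_product fps_sum_nth sum.cartesian_product case_prod_unfold)
  also have "\<dots> = (translate q c f * translate q c g) $ i"
    by (intro fps_mult_nth_cong) (simp_all add: translate_nth[OF assms])
  finally show "translate q c (f * g) $ i = (translate q c f * translate q c g) $ i" .
qed

lemma translate_add: "translate q c (f + g) = translate q c f + translate q c g"
  by (rule fps_ext) (simp add: translate_def dz_funpow_add smult_add_right sum.distrib)

lemma translate_diff: "translate q c (f - g) = translate q c f - translate q c g"
  by (rule fps_ext) (simp add: translate_def dz_funpow_diff smult_diff_right sum_subtractf)

lemma translate_0 [simp]: "translate q c 0 = 0"
  using translate_diff[of q c 0 0] by simp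

lemma translate_minus: "translate q c (- f) = - translate q c f"
  using translate_diff[of q c 0 f] by simp

lemma translate_sum: "translate q c (sum f A) = (\<Sum>x\<in>A. translate q c (f x))"
  by (induction A rule: infinite_finite_induct) (simp_all add: translate_add)

lemma translate_const_mult:
  "translate q c (fps_const [:a:] * f) = fps_const [:a:] * translate q c f"
  by (rule fps_ext) (simp add: translate_def dz_funpow_const_mult smult_sum_right mult.commute[of a])

lemma translate_const [simp]: "translate q c (fps_const [:a:]) = fps_const [:a:]"
proof (rule fps_ext)
  fix i
  have "(dz q ^^ k) (fps_const [:a:]) = (if k = 0 then fps_const [:a:] else 0)" for k
    by (induction k) auto
  then have "translate q c (fps_const [:a:]) $ i =
      (\<Sum>j\<le>i. if j = 0 then (fps_const [:a:]) $ i else 0)"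
    unfolding translate_def fps_nth_Abs_fps by (intro sum.cong) auto
  then show "translate q c (fps_const [:a:]) $ i = (fps_const [:a:]) $ i" by simp
qed

lemma translate_power:
  assumes "q \<ge> 1"
  shows "translate q c (f ^ k) = translate q c f ^ k"
proof (induction k)
  case 0
  show ?case using translate_const[of q c 1] by (simp flip: one_pCons)
qed (simp add: translate_mult[OF assms])

lemma translate_nth_cong:
  assumes "\<And>j. j \<le> i \<Longrightarrow> f $ j = g $ j"
  shows "translate q c f $ i = translate q c g $ i"
  unfolding translate_def fps_nth_Abs_fps
  by (intro sum.cong refl arg_cong[where f = "smult _"] dz_funpow_nth_cong[where N = i]) (simp_all add: assms)

lemma translate_nth_low:
  assumes "\<And>j. j < t \<Longrightarrow> f $ j = 0" "q \<ge> 1" "i < t + q"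
  shows "translate q c f $ i = f $ i"
proof -
  have "(dz q ^^ j) f $ i = 0" if "j \<noteq> 0" for j
  proof (rule dz_funpow_nth_eq_0[OF assms(1)])
    show "i < t + j * q" using that assms(3) by (cases j) auto
  qed
  then have "translate q c f $ i = (\<Sum>j\<le>i. if j = 0 then f $ i else 0)"
    unfolding translate_def fps_nth_Abs_fps by (intro sum.cong) auto
  then show ?thesis by simp
qed

lemma translate_nth_0 [simp]: "q \<ge> 1 \<Longrightarrow> translate q c f $ 0 = f $ 0"
  by (rule translate_nth_low[where t = 0]) auto

text \<open>The first coefficient that a translation can change, linearly in c; this is where the
  shift between two solutions is read off.\<close>

lemma translate_nth_first_order:
  assumes "\<And>j. j < t \<Longrightarrow> f $ j = 0" "q \<ge> 1"
  shows "translate q c f $ (t + q) =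
    f $ (t + q) + smult c (pderiv (f $ t) - smult (of_nat t / of_nat q) (f $ t))"
proof -
  have 0: "(dz q ^^ j) f $ (t + q) = 0" if "j \<noteq> 0" "j \<noteq> 1" for j
  proof (rule dz_funpow_nth_eq_0[OF assms(1)])
    have "1 * q < j * q" using that assms(2) by (intro mult_strict_right_mono) auto
    then show "t + q < t + j * q" by simp
  qed
  have "translate q c f $ (t + q) =
      (\<Sum>j\<le>t + q. (if j = 0 then f $ (t + q) else 0) + (if j = 1 then smult c (dz q f $ (t + q)) else 0))"
    unfolding translate_def fps_nth_Abs_fps by (intro sum.cong refl) (use 0 in auto)
  then show ?thesis using assms(2) by (simp add: sum.distrib)
qed

lemma dz_translate:
  assumes "q \<ge> 1"
  shows "dz q (translate q c f) = translate q c (dz q f)"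
proof (rule fps_ext)
  fix i
  have comm: "(dz q ^^ k) (dz q f) = dz q ((dz q ^^ k) f)" for k
    by (simp add: funpow_swap1)
  have "dz q (translate q c f) $ i = (dz q ^^ 1) (\<Sum>k\<le>i. taylor_term q c k f) $ i"
    using dz_funpow_nth_cong[where N = i and i = i and k = 1 and q = q, OF translate_nth[OF assms]] by simp
  also have "\<dots> = (\<Sum>k\<le>i. taylor_term q c k (dz q f)) $ i"
    by (simp add: dz_sum taylor_term_def dz_const_mult comm)
  also have "\<dots> = translate q c (dz q f) $ i"
    by (simp add: translate_nth[OF assms order_refl])
  finally show "dz q (translate q c f) $ i = translate q c (dz q f) $ i" .
qed

lemma dz_funpow_translate:
  "q \<ge> 1 \<Longrightarrow> (dz q ^^ k) (translate q c f) = translate q c ((dz q ^^ k) f)"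
  by (induction k) (simp_all add: dz_translate)

text \<open>Both sides expand into one double Taylor sum, symmetric in the two shifts. With one
  shift equal to 1 or -1 this makes \<open>delta2\<close> commute with translations.\<close>

lemma translate_commute:
  assumes "q \<ge> 1"
  shows "translate q c (translate q d f) = translate q d (translate q c f)"
proof (rule fps_ext)
  fix i
  have eq: "translate q c (translate q d f) $ i =
      (\<Sum>k\<le>i. \<Sum>j\<le>i. smult (c ^ k / fact k * (d ^ j / fact j)) ((dz q ^^ (j + k)) f $ i))" for c d
    unfolding translate_def[of q c] fps_nth_Abs_fps dz_funpow_translate[OF assms]
    by (simp add: translate_def smult_sum_right funpow_add)
  show "translate q c (translate q d f) $ i = translate q d (translate q c f) $ i"
    unfolding eq by (subst sum.swap) (simp add: mult.commute add.commute)
qed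

lemma translate_delta2:
  assumes "q \<ge> 1"
  shows "translate q c (delta2 q f) = delta2 q (translate q c f)"
proof -
  have "(2 :: zseries) = fps_const [:2:]" by (simp add: numeral_fps_const numeral_poly)
  then have "translate q c (2 * f) = 2 * translate q c f"
    using translate_const_mult[of q c 2 f] by (simp only:)
  then show ?thesis
    by (simp add: delta2_def translate_add translate_diff translate_commute[OF assms, of c])
qed

text \<open>u^k has order at least k, so up to index N the composition is a polynomial in u, and
  statements about compositions reduce to finite sums.\<close>

lemma const_series_compose_nth:
  assumes "u $ 0 = 0" "i \<le> N"
  shows "(Abs_fps (\<lambda>k. [:a k:]) oo u) $ i = (\<Sum>k\<le>N. fps_const [:a k:] * u ^ k) $ i"
proof -
  have "(\<Sum>k\<le>N. fps_const [:a k:] * u ^ k) $ i = (\<Sum>k\<le>N. [:a k:] * u ^ k $ i)"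
    by (simp add: fps_sum_nth)
  also have "\<dots> = (\<Sum>k\<le>i. [:a k:] * u ^ k $ i)"
    using assms by (intro sum.mono_neutral_right) (auto simp: startsby_zero_power_prefix)
  finally show ?thesis by (simp add: fps_compose_nth atLeast0AtMost)
qed

lemma translate_compose:
  assumes "q \<ge> 1" "u $ 0 = 0"
  shows "translate q c (Abs_fps (\<lambda>k. [:a k:]) oo u) = Abs_fps (\<lambda>k. [:a k:]) oo translate q c u"
proof (rule fps_ext)
  fix i
  have "translate q c (Abs_fps (\<lambda>k. [:a k:]) oo u) $ i = translate q c (\<Sum>k\<le>i. fps_const [:a k:] * u ^ k) $ i"
    by (intro translate_nth_cong const_series_compose_nth assms) auto
  also have "\<dots> = (\<Sum>k\<le>i. fps_const [:a k:] * translate q c u ^ k) $ i"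
    by (simp add: translate_sum translate_const_mult translate_power[OF assms(1)])
  also have "\<dots> = (Abs_fps (\<lambda>k. [:a k:]) oo translate q c u) $ i"
    using assms by (intro const_series_compose_nth[symmetric]) auto
  finally show "translate q c (Abs_fps (\<lambda>k. [:a k:]) oo u) $ i = (Abs_fps (\<lambda>k. [:a k:]) oo translate q c u) $ i" .
qed

lemma dz_exp_compose:
  assumes "u $ 0 = 0"
  shows "dz q (Abs_fps (\<lambda>k. [:1 / fact k:]) oo u) = dz q u * (Abs_fps (\<lambda>k. [:1 / fact k:]) oo u)"
proof (rule fps_ext)
  fix i
  let ?E = "Abs_fps (\<lambda>k. [:1 / fact k:]) :: zseries"
  have dz_term: "dz q (fps_const [:1 / fact (Suc k):] * u ^ Suc k) = dz q u * (fps_const [:1 / fact k:] * u ^ k)" for k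
  proof -
    have "fps_const [:1 / fact (Suc k):] * fps_const [:of_nat (Suc k):] = fps_const [:1 / fact k :: complex:]"
      by (simp add: field_simps del: of_nat_Suc)
    then show ?thesis
      unfolding dz_const_mult dz_power by (metis (no_types, lifting) mult.assoc mult.commute)
  qed
  \<comment> \<open>One more term than the index requires: the term k = 0 is killed by
    \<open>dz\<close>, and the others shift down to k = 0, ..., i.\<close>
  have "dz q (?E oo u) $ i = (dz q ^^ 1) (\<Sum>k\<le>Suc i. fps_const [:1 / fact k:] * u ^ k) $ i"
    using dz_funpow_nth_cong[where N = "Suc i" and i = i and k = 1 and q = q, OF const_series_compose_nth[OF assms]]
    by (simp del: sum.atMost_Suc)
  also have "\<dots> = (dz q u * (\<Sum>k\<le>i. fps_const [:1 / fact k:] * u ^ k)) $ i"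
  proof -
    have "dz q (fps_const [:1 / fact 0:] * u ^ 0) = 0" by (simp flip: one_pCons) (metis dz_const one_pCons fps_const_1_eq_1)
    then show ?thesis
      unfolding sum.atMost_Suc_shift
      by (simp add: dz_add dz_sum dz_term sum_distrib_left del: fact_Suc power_Suc)
  qed
  also have "\<dots> = (dz q u * (?E oo u)) $ i"
    by (intro fps_mult_nth_cong refl) (simp add: const_series_compose_nth[OF assms])
  finally show "dz q (?E oo u) $ i = (dz q u * (?E oo u)) $ i" .
qed

section \<open>Series with analytic coefficients and controlled logarithms\<close>

text \<open>
  Families \<open>w\<^sup>a h(w\<^sup>2)\<close> in which \<open>log\<^sup>j z\<close> comes with at least \<open>w\<^bsup>a+qj\<^esup>\<close> (and does not occur for
  \<open>j > 0\<close> unless \<open>lg\<close>).  For even \<open>q\<close>, \<open>a = 2\<close> and \<open>a = 0\<close> give the bounds on the powers of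
  \<open>log z\<close> in the cases (P) and (T).
\<close>

definition admissible :: "bool \<Rightarrow> nat \<Rightarrow> real \<Rightarrow> nat \<Rightarrow> (complex \<Rightarrow> zseries) \<Rightarrow> bool" where
  "admissible lg q R a F \<longleftrightarrow>
     (\<forall>i j. (\<lambda>\<mu>. coeff (F \<mu> $ i) j) analytic_on ball 0 R) \<and>
     (\<forall>\<mu>\<in>ball 0 R. \<forall>i j. coeff (F \<mu> $ i) j \<noteq> 0 \<longrightarrow>
        (\<exists>k. i = a + 2 * k \<and> (j = 0 \<or> lg \<and> q * j \<le> 2 * k)))"

lemma admissibleI:
  assumes "\<And>i j. (\<lambda>\<mu>. coeff (F \<mu> $ i) j) analytic_on ball 0 R"
    and "\<And>\<mu> i j. \<mu> \<in> ball 0 R \<Longrightarrow> coeff (F \<mu> $ i) j \<noteq> 0 \<Longrightarrow>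
           \<exists>k. i = a + 2 * k \<and> (j = 0 \<or> lg \<and> q * j \<le> 2 * k)"
  shows "admissible lg q R a F"
  using assms unfolding admissible_def by blast

lemma admissible_analytic:
  "admissible lg q R a F \<Longrightarrow> (\<lambda>\<mu>. coeff (F \<mu> $ i) j) analytic_on ball 0 R"
  by (simp add: admissible_def)

lemma admissible_support:
  assumes "admissible lg q R a F" "\<mu> \<in> ball 0 R" "coeff (F \<mu> $ i) j \<noteq> 0"
  obtains k where "i = a + 2 * k" "j = 0 \<or> lg \<and> q * j \<le> 2 * k"
  using assms unfolding admissible_def by blast

text \<open>A criterion per coefficient: an infinite sum may be replaced by whichever finite
  truncation has the right i-th coefficient.\<close>

lemma admissible_local:
  assumes "\<And>i. \<exists>F'. admissible lg q R a F' \<and> (\<forall>\<mu>\<in>ball 0 R. F \<mu> $ i = F' \<mu> $ i)"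
  shows "admissible lg q R a F"
proof (rule admissibleI)
  fix i j
  obtain F' where F': "admissible lg q R a F'" "\<And>\<mu>. \<mu> \<in> ball 0 R \<Longrightarrow> F \<mu> $ i = F' \<mu> $ i"
    using assms by blast
  show "(\<lambda>\<mu>. coeff (F \<mu> $ i) j) analytic_on ball 0 R"
    by (rule analytic_on_ball_cong[OF admissible_analytic[OF F'(1), of i j]]) (simp add: F'(2))
  show "\<exists>k. i = a + 2 * k \<and> (j = 0 \<or> lg \<and> q * j \<le> 2 * k)"
    if "\<mu> \<in> ball 0 R" "coeff (F \<mu> $ i) j \<noteq> 0" for \<mu>
    using F' that unfolding admissible_def by auto
qed

lemma admissible_cong:
  assumes "admissible lg q R a F" "\<And>\<mu>. \<mu> \<in> ball 0 R \<Longrightarrow> F \<mu> = G \<mu>"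
  shows "admissible lg q R a G"
  by (rule admissible_local) (use assms in auto)

lemma admissible_mono:
  assumes "admissible lg q R a F" "a = b + 2 * d"
  shows "admissible lg q R b F"
proof (rule admissibleI)
  fix \<mu> i j assume "\<mu> \<in> ball 0 R" "coeff (F \<mu> $ i) j \<noteq> 0"
  then obtain k where "i = a + 2 * k" "j = 0 \<or> lg \<and> q * j \<le> 2 * k"
    using admissible_support[OF assms(1)] by metis
  then show "\<exists>k. i = b + 2 * k \<and> (j = 0 \<or> lg \<and> q * j \<le> 2 * k)"
    using assms(2) by (intro exI[of _ "k + d"]) auto
qed (rule admissible_analytic[OF assms(1)])

lemma admissible_0: "admissible lg q R a (\<lambda>\<mu>. 0)"
  by (rule admissibleI) auto

lemma admissible_add:
  assumes "admissible lg q R a F" "admissible lg q R a G"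
  shows "admissible lg q R a (\<lambda>\<mu>. F \<mu> + G \<mu>)"
proof (rule admissibleI)
  fix \<mu> i j assume *: "\<mu> \<in> ball 0 R" "coeff ((F \<mu> + G \<mu>) $ i) j \<noteq> 0"
  then have "coeff (F \<mu> $ i) j \<noteq> 0 \<or> coeff (G \<mu> $ i) j \<noteq> 0" by auto
  then show "\<exists>k. i = a + 2 * k \<and> (j = 0 \<or> lg \<and> q * j \<le> 2 * k)"
    using *(1) assms unfolding admissible_def by blast
qed (use assms in \<open>auto intro!: analytic_intros admissible_analytic\<close>)

lemma admissible_mult:
  assumes "admissible lg q R a F" "admissible lg q R b G"
  shows "admissible lg q R (a + b) (\<lambda>\<mu>. F \<mu> * G \<mu>)"
proof (rule admissibleI)
  have eq: "coeff ((F \<mu> * G \<mu>) $ i) j =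
      (\<Sum>k=0..i. \<Sum>l\<le>j. coeff (F \<mu> $ k) l * coeff (G \<mu> $ (i - k)) (j - l))" for \<mu> i j
    by (simp add: fps_mult_nth coeff_sum coeff_mult)
  show "(\<lambda>\<mu>. coeff ((F \<mu> * G \<mu>) $ i) j) analytic_on ball 0 R" for i j
    unfolding eq by (intro analytic_on_sum analytic_on_mult admissible_analytic[OF assms(1)] admissible_analytic[OF assms(2)])
  fix \<mu> i j assume *: "\<mu> \<in> ball 0 R" "coeff ((F \<mu> * G \<mu>) $ i) j \<noteq> 0"
  from *(2) obtain k where "k \<in> {0..i}" "(\<Sum>l\<le>j. coeff (F \<mu> $ k) l * coeff (G \<mu> $ (i - k)) (j - l)) \<noteq> 0"
    unfolding eq by (rule sum.not_neutral_contains_not_neutral)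
  moreover from this(2) obtain l where "l \<in> {..j}" "coeff (F \<mu> $ k) l * coeff (G \<mu> $ (i - k)) (j - l) \<noteq> 0"
    by (rule sum.not_neutral_contains_not_neutral)
  ultimately have kl: "k \<le> i" "l \<le> j" "coeff (F \<mu> $ k) l \<noteq> 0" "coeff (G \<mu> $ (i - k)) (j - l) \<noteq> 0"
    by auto
  obtain s where s: "k = a + 2 * s" "l = 0 \<or> lg \<and> q * l \<le> 2 * s"
    using admissible_support[OF assms(1) *(1) kl(3)] by blast
  obtain t where t: "i - k = b + 2 * t" "j - l = 0 \<or> lg \<and> q * (j - l) \<le> 2 * t"
    using admissible_support[OF assms(2) *(1) kl(4)] by blast
  \<comment> \<open>Exponents of log z add just as orders in w do, so the log budget of the product
    is the sum of the two budgets.\<close>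
  have "q * j = q * l + q * (j - l)"
    using kl(2) by (metis add_mult_distrib2 le_add_diff_inverse)
  then show "\<exists>k. i = a + b + 2 * k \<and> (j = 0 \<or> lg \<and> q * j \<le> 2 * k)"
    using s t kl by (intro exI[of _ "s + t"]) auto
qed

lemma admissible_const:
  assumes "c analytic_on ball 0 R"
  shows "admissible lg q R 0 (\<lambda>\<mu>. fps_const [:c \<mu>:])"
proof (rule admissibleI)
  fix i j
  show "(\<lambda>\<mu>. coeff (fps_const [:c \<mu>:] $ i) j) analytic_on ball 0 R"
    using assms by (cases "i = 0"; cases j) auto
qed (auto simp: coeff_pCons split: nat.splits if_splits)

lemma admissible_fps_X_power: "admissible lg q R k (\<lambda>\<mu>. fps_X ^ k)"
proof (rule admissibleI)
  fix \<mu> :: complex and i j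
  assume "coeff ((fps_X ^ k :: zseries) $ i) j \<noteq> 0"
  then show "\<exists>l. i = k + 2 * l \<and> (j = 0 \<or> lg \<and> q * j \<le> 2 * l)"
    by (cases "i = k"; cases j) auto
qed auto

lemma admissible_const_mult:
  assumes "c analytic_on ball 0 R" "admissible lg q R a F"
  shows "admissible lg q R a (\<lambda>\<mu>. fps_const [:c \<mu>:] * F \<mu>)"
  using admissible_mult[OF admissible_const[OF assms(1)] assms(2)] by simp

lemma admissible_diff:
  assumes "admissible lg q R a F" "admissible lg q R a G"
  shows "admissible lg q R a (\<lambda>\<mu>. F \<mu> - G \<mu>)"
proof -
  have "admissible lg q R a (\<lambda>\<mu>. F \<mu> + fps_const [:-1:] * G \<mu>)"
    by (intro admissible_add admissible_const_mult assms analytic_on_const)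
  moreover have "fps_const [:-1:] * f = - f" for f :: zseries
    by (rule fps_ext) simp
  ultimately show ?thesis by simp
qed

lemma admissible_power:
  assumes "admissible lg q R a F"
  shows "admissible lg q R (k * a) (\<lambda>\<mu>. F \<mu> ^ k)"
proof (induction k)
  case 0
  show ?case using admissible_const[of "\<lambda>_. 1" R lg q] by (simp flip: one_pCons)
qed (use admissible_mult[OF assms] in simp)

lemma admissible_sum:
  assumes "\<And>x. x \<in> A \<Longrightarrow> admissible lg q R a (F x)"
  shows "admissible lg q R a (\<lambda>\<mu>. \<Sum>x\<in>A. F x \<mu>)"
  using assms by (induction A rule: infinite_finite_induct) (auto intro: admissible_0 admissible_add)

lemma admissible_dz:
  assumes "admissible lg q R a F"
  shows "admissible lg q R (a + q) (\<lambda>\<mu>. dz q (F \<mu>))"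
proof (rule admissibleI)
  have eq: "coeff (dz q (F \<mu>) $ i) j = (if i < q then 0 else
      of_nat (Suc j) * coeff (F \<mu> $ (i - q)) (Suc j) - of_nat (i - q) / of_nat q * coeff (F \<mu> $ (i - q)) j)" for \<mu> i j
    by (simp add: dz_nth coeff_pderiv)
  show "(\<lambda>\<mu>. coeff (dz q (F \<mu>) $ i) j) analytic_on ball 0 R" for i j
    unfolding eq using admissible_analytic[OF assms]
    by (cases "i < q") (simp_all only: if_True if_False simp_thms analytic_on_const, intro analytic_on_diff analytic_on_mult analytic_on_const)
  fix \<mu> i j assume *: "\<mu> \<in> ball 0 R" "coeff (dz q (F \<mu>) $ i) j \<noteq> 0"
  then have "i \<ge> q" "coeff (F \<mu> $ (i - q)) (Suc j) \<noteq> 0 \<or> coeff (F \<mu> $ (i - q)) j \<noteq> 0"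
    unfolding eq by (auto split: if_splits)
  then obtain j' where "coeff (F \<mu> $ (i - q)) j' \<noteq> 0" "i \<ge> q" "j \<le> j'"
    using Suc_leD order_refl by metis
  moreover from this obtain s where "i - q = a + 2 * s" "j' = 0 \<or> lg \<and> q * j' \<le> 2 * s"
    using admissible_support[OF assms *(1)] by blast
  moreover have "q * j \<le> t" if "q * j' \<le> t" for t
    using that \<open>j \<le> j'\<close> by (meson mult_le_mono2 order.trans)
  ultimately show "\<exists>k. i = a + q + 2 * k \<and> (j = 0 \<or> lg \<and> q * j \<le> 2 * k)"
    by (intro exI[of _ s]) auto
qed

lemma admissible_dz_funpow:
  "admissible lg q R a F \<Longrightarrow> admissible lg q R (a + k * q) (\<lambda>\<mu>. (dz q ^^ k) (F \<mu>))"
proof (induction k)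
  case (Suc k)
  then have "admissible lg q R (a + k * q + q) (\<lambda>\<mu>. dz q ((dz q ^^ k) (F \<mu>)))"
    by (intro admissible_dz)
  then show ?case by (simp add: algebra_simps)
qed simp

text \<open>
  Only \<open>dz q F\<close> is required to be admissible, so that this applies to
  \<open>\<phi>\<^sub>0\<close>, whose logarithm is too large for the filtration.
\<close>

lemma admissible_delta2_of_dz:
  assumes "admissible lg q R (a + q) (\<lambda>\<mu>. dz q (F \<mu>))"
  shows "admissible lg q R (a + 2 * q) (\<lambda>\<mu>. delta2 q (F \<mu>))"
proof (rule admissible_local)
  fix i
  have "admissible lg q R (a + 2 * q) (\<lambda>\<mu>. \<Sum>j\<in>{1..i div 2}. fps_const [:2 / fact (2 * j):] * (dz q ^^ (2 * j)) (F \<mu>))"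
  proof (intro admissible_sum admissible_const_mult analytic_on_const)
    fix j assume "j \<in> {1..i div 2}"
    \<comment> \<open>As j >= 1, one of the 2j derivatives can be taken from the hypothesis; 2l + 1
      of them remain.\<close>
    then obtain l where l: "j = Suc l" by (cases j) auto
    have "admissible lg q R (a + q + (2 * l + 1) * q) (\<lambda>\<mu>. (dz q ^^ (2 * l + 1)) (dz q (F \<mu>)))"
      by (rule admissible_dz_funpow[OF assms])
    moreover have "(dz q ^^ (2 * l + 1)) (dz q f) = (dz q ^^ (2 * j)) f" for f
      by (simp add: l funpow_swap1)
    ultimately have "admissible lg q R (a + q + (2 * l + 1) * q) (\<lambda>\<mu>. (dz q ^^ (2 * j)) (F \<mu>))"
      by (simp only:)
    then show "admissible lg q R (a + 2 * q) (\<lambda>\<mu>. (dz q ^^ (2 * j)) (F \<mu>))"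
      by (rule admissible_mono[where d = "l * q"]) (simp add: algebra_simps)
  qed
  then show "\<exists>F'. admissible lg q R (a + 2 * q) F' \<and> (\<forall>\<mu>\<in>ball 0 R. delta2 q (F \<mu>) $ i = F' \<mu> $ i)"
    by (rule_tac exI, rule_tac conjI, assumption) (simp add: delta2_sinh fps_sum_nth)
qed

lemma admissible_delta2:
  "admissible lg q R a F \<Longrightarrow> admissible lg q R (a + 2 * q) (\<lambda>\<mu>. delta2 q (F \<mu>))"
  by (intro admissible_delta2_of_dz admissible_dz)

text \<open>The powers with k >= N start at w^(ks); for even s this differs from w^(Ns) by an even
  power, as the filtration demands.\<close>

lemma admissible_compose:
  assumes "\<And>k. a k analytic_on ball 0 R" "admissible lg q R s F" "\<And>\<mu>. \<mu> \<in> ball 0 R \<Longrightarrow> F \<mu> $ 0 = 0"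
    and "\<And>k \<mu>. k < N \<Longrightarrow> \<mu> \<in> ball 0 R \<Longrightarrow> a k \<mu> = 0" "even s"
  shows "admissible lg q R (N * s) (\<lambda>\<mu>. Abs_fps (\<lambda>k. [:a k \<mu>:]) oo F \<mu>)"
proof (rule admissible_local)
  fix i
  have "admissible lg q R (N * s) (\<lambda>\<mu>. \<Sum>k\<le>i. fps_const [:a k \<mu>:] * F \<mu> ^ k)"
  proof (rule admissible_sum)
    fix k assume "k \<in> {..i}"
    show "admissible lg q R (N * s) (\<lambda>\<mu>. fps_const [:a k \<mu>:] * F \<mu> ^ k)"
    proof (cases "k < N")
      case True
      show ?thesis by (rule admissible_cong[OF admissible_0]) (use True assms(4) in simp)
    next
      case False
      have "admissible lg q R (k * s) (\<lambda>\<mu>. fps_const [:a k \<mu>:] * F \<mu> ^ k)"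
        by (intro admissible_const_mult admissible_power assms)
      moreover obtain t where t: "s = 2 * t" using \<open>even s\<close> by auto
      moreover have "k * t = N * t + (k - N) * t"
        using False by (simp flip: add_mult_distrib)
      then have "k * s = N * s + 2 * ((k - N) * t)" by (simp add: t)
      ultimately show ?thesis
        using admissible_mono by blast
    qed
  qed
  then show "\<exists>F'. admissible lg q R (N * s) F' \<and> (\<forall>\<mu>\<in>ball 0 R. (Abs_fps (\<lambda>k. [:a k \<mu>:]) oo F \<mu>) $ i = F' \<mu> $ i)"
    by (rule_tac exI, rule_tac conjI, assumption) (auto intro!: const_series_compose_nth assms)
qed

text \<open>The log budget is counted relative to w^a, so dividing by w^a leaves it
  unchanged.\<close>

lemma admissible_shift:
  assumes "admissible lg q R a F"
  shows "admissible lg q R 0 (\<lambda>\<mu>. fps_shift a (F \<mu>))"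
proof (rule admissibleI)
  fix \<mu> i j assume "\<mu> \<in> ball 0 R" "coeff (fps_shift a (F \<mu>) $ i) j \<noteq> 0"
  then obtain k where "i + a = a + 2 * k" "j = 0 \<or> lg \<and> q * j \<le> 2 * k"
    using admissible_support[OF assms, of \<mu> "i + a" j] by auto
  then show "\<exists>k. i = 0 + 2 * k \<and> (j = 0 \<or> lg \<and> q * j \<le> 2 * k)"
    by auto
qed (simp add: admissible_analytic[OF assms])

section \<open>Equations with one resonance\<close>

text \<open>
  \<open>E \<mu> u\<close> stands for the residual of a correction \<open>u\<close>, divided by the leading power of \<open>w\<close>.
\<close>

locale resonant_equation =
  fixes q :: nat and R :: real and E :: "complex \<Rightarrow> zseries \<Rightarrow> zseries" and a b :: "nat \<Rightarrow> complex"
  assumes q: "q \<ge> 1"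
    and a: "\<And>i. a i \<noteq> 0"
    and b: "\<And>i. i \<ge> 1 \<Longrightarrow> b i = 0 \<longleftrightarrow> i = q"
    and triangular: "\<And>\<mu> u v i. \<mu> \<in> ball 0 R \<Longrightarrow> u $ 0 = 0 \<Longrightarrow> v $ 0 = 0 \<Longrightarrow> i \<ge> 1 \<Longrightarrow>
      (\<And>j. j < i \<Longrightarrow> u $ j = v $ j) \<Longrightarrow>
      E \<mu> u $ i - E \<mu> v $ i = second_order_op (a i) (b i) (u $ i - v $ i)"
    and E_nth_0: "\<And>\<mu> u. \<mu> \<in> ball 0 R \<Longrightarrow> u $ 0 = 0 \<Longrightarrow> E \<mu> u $ 0 = 0"
    and E_admissible: "\<And>lg u. admissible lg q R 0 u \<Longrightarrow> (\<And>\<mu>. u \<mu> $ 0 = 0) \<Longrightarrow>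
      admissible lg q R 0 (\<lambda>\<mu>. E \<mu> (u \<mu>))"
begin

lemma solution_unique:
  assumes "\<mu> \<in> ball 0 R" "u $ 0 = 0" "v $ 0 = 0" "E \<mu> u = 0" "E \<mu> v = 0"
    and res: "coeff (u $ q) 0 = coeff (v $ q) 0"
  shows "u = v"
proof -
  have "u $ i = v $ i" for i
  proof (induction i rule: less_induct)
    case (less i)
    show ?case
    proof (cases "i = 0")
      case False
      then have 0: "second_order_op (a i) (b i) (u $ i - v $ i) = 0"
        using triangular[OF assms(1-3), of i] less assms(4,5) by simp
      show ?thesis
      proof (cases "i = q")
        case True
        then have "b i = 0" using b False by simp
        then have "u $ i - v $ i = 0"
          using second_order_op_eq_0_resonant[of "a i" "u $ i - v $ i"] 0 a[of i] True res by simp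
        then show ?thesis by simp
      next
        case False
        then have "b i \<noteq> 0" using b \<open>i \<noteq> 0\<close> by simp
        then show ?thesis using second_order_op_eq_0_nonresonant[OF 0] by simp
      qed
    qed (use assms in simp)
  qed
  then show ?thesis by (rule fps_ext)
qed

text \<open>Membership with base 0, split into conditions on single coefficients, so that a series
  can be built one coefficient at a time.\<close>

definition coeff_admissible :: "bool \<Rightarrow> nat \<Rightarrow> (complex \<Rightarrow> complex poly) \<Rightarrow> bool" where
  "coeff_admissible lg i p \<longleftrightarrow>
     (\<forall>j. (\<lambda>\<mu>. coeff (p \<mu>) j) analytic_on ball 0 R) \<and>
     (\<forall>\<mu>\<in>ball 0 R. \<forall>j. coeff (p \<mu>) j \<noteq> 0 \<longrightarrow> even i \<and> (j = 0 \<or> lg \<and> q * j \<le> i))"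

lemma admissible_iff_coeff_admissible:
  "admissible lg q R 0 F \<longleftrightarrow> (\<forall>i. coeff_admissible lg i (\<lambda>\<mu>. F \<mu> $ i))"
proof -
  have "(\<exists>k. i = 0 + 2 * k \<and> (j = 0 \<or> lg \<and> q * j \<le> 2 * k)) \<longleftrightarrow> even i \<and> (j = 0 \<or> lg \<and> q * j \<le> i)" for i j
    by (auto elim: evenE)
  then show ?thesis unfolding admissible_def coeff_admissible_def by (simp only:) blast
qed

text \<open>
  For even \<open>q\<close>, no logarithm occurs before the resonance, so the resonant right-hand side is
  constant and produces just one logarithm.  For odd \<open>q\<close> it vanishes by parity.
\<close>

lemma next_coeff:
  assumes prev: "admissible (even q) q R 0 u" "\<And>\<mu>. u \<mu> $ 0 = 0" "\<And>\<mu> j. j \<ge> i \<Longrightarrow> u \<mu> $ j = 0"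
    and "i \<ge> 1"
  obtains p where "coeff_admissible (even q) i p"
    and "\<And>\<mu>. \<mu> \<in> ball 0 R \<Longrightarrow> second_order_op (a i) (b i) (p \<mu>) = - (E \<mu> (u \<mu>) $ i)"
    and "i = q \<Longrightarrow> \<forall>\<mu>\<in>ball 0 R. coeff (p \<mu>) 0 = 0"
proof (cases "i = q")
  case False
  define h where "h \<mu> = - (E \<mu> (u \<mu>) $ i)" for \<mu>
  have E_adm: "coeff_admissible (even q) i (\<lambda>\<mu>. E \<mu> (u \<mu>) $ i)"
    using E_admissible[OF prev(1,2)] by (simp add: admissible_iff_coeff_admissible)
  have h_an: "(\<lambda>\<mu>. coeff (h \<mu>) j) analytic_on ball 0 R" for j
    using E_adm by (simp add: coeff_admissible_def h_def analytic_on_neg)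
  have h_supp: "even i \<and> (j = 0 \<or> even q \<and> q * j \<le> i)" if "\<mu> \<in> ball 0 R" "coeff (h \<mu>) j \<noteq> 0" for \<mu> j
    using E_adm that by (simp add: coeff_admissible_def h_def)
  have bi: "b i \<noteq> 0" using False b \<open>i \<ge> 1\<close> by simp
  have "\<exists>p. second_order_op (a i) (b i) p = h \<mu>" for \<mu>
    using second_order_op_surj[OF bi] by metis
  \<comment> \<open>A pointwise choice in \<mu>; analyticity is restored by
    \<open>preimage_analytic\<close>.\<close>
  then obtain p where p: "\<And>\<mu>. second_order_op (a i) (b i) (p \<mu>) = h \<mu>"
    by metis
  have h_bound: "coeff (h \<mu>) j = 0" if "\<mu> \<in> ball 0 R" "j > i" for \<mu> j
  proof (rule ccontr)
    assume "coeff (h \<mu>) j \<noteq> 0"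
    then have "q * j \<le> i" using h_supp[OF that(1)] that(2) by auto
    moreover have "j \<le> q * j" using q by simp
    ultimately show False using that(2) by linarith
  qed
  show ?thesis
  proof (rule that[of p])
    show "coeff_admissible (even q) i p"
      unfolding coeff_admissible_def
    proof (intro conjI allI ballI impI)
      show "(\<lambda>\<mu>. coeff (p \<mu>) j) analytic_on ball 0 R" for j
        by (rule preimage_analytic[OF p bi h_an h_bound])
      fix \<mu> j assume \<mu>: "\<mu> \<in> ball 0 R" and nz: "coeff (p \<mu>) j \<noteq> 0"
      \<comment> \<open>The preimage has no higher power of log z than the right-hand side, so its
        log budget is inherited from some j' >= j.\<close>
      have "\<exists>j'\<ge>j. coeff (h \<mu>) j' \<noteq> 0"
      proof (rule ccontr)
        assume "\<not> ?thesis"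
        then have 0: "coeff (h \<mu>) j' = 0" if "j' \<ge> j" for j'
          using that by blast
        show False
        proof (cases j)
          case z: 0
          then have "h \<mu> = 0" using 0 by (simp add: poly_eq_iff)
          then show False using p[of \<mu>] second_order_op_eq_0_nonresonant[OF _ bi, of "a i" "p \<mu>"] nz by simp
        next
          case (Suc l)
          then show False using coeff_preimage_eq_0[OF p[of \<mu>] bi, of l j] 0 nz by simp
        qed
      qed
      then obtain j' where "j' \<ge> j" "coeff (h \<mu>) j' \<noteq> 0" by blast
      with h_supp[OF \<mu>] have "even i \<and> (j' = 0 \<or> even q \<and> q * j' \<le> i)" by blast
      moreover have "q * j \<le> t" if "q * j' \<le> t" for t
        using that \<open>j' \<ge> j\<close> by (meson mult_le_mono2 order.trans)
      ultimately show "even i" "j = 0 \<or> even q \<and> q * j \<le> i" using \<open>j' \<ge> j\<close> by auto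
    qed
  qed (use p False h_def in auto)
next
  case True
  have "admissible False q R 0 u"
  proof (rule admissibleI)
    fix \<mu> l j assume *: "\<mu> \<in> ball 0 R" "coeff (u \<mu> $ l) j \<noteq> 0"
    then obtain k where k: "l = 0 + 2 * k" "j = 0 \<or> even q \<and> q * j \<le> 2 * k"
      using admissible_support[OF prev(1)] by metis
    \<comment> \<open>Below the resonance q j <= l < q leaves only j = 0, so \<open>u\<close> is
      free of logarithms.\<close>
    have "l < q" using *(2) prev(3)[of l \<mu>] True by (cases "l < q") auto
    with k have "j = 0" by (cases j) auto
    with k show "\<exists>k. l = 0 + 2 * k \<and> (j = 0 \<or> False \<and> q * j \<le> 2 * k)" by blast
  qed (rule admissible_analytic[OF prev(1)])
  then have adm: "coeff_admissible False q (\<lambda>\<mu>. E \<mu> (u \<mu>) $ q)"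
    using E_admissible[OF _ prev(2)] by (simp add: admissible_iff_coeff_admissible)
  \<comment> \<open>For p = k x the operator with b = 0 gives -a k, so k = E_q / a produces the
    right-hand side -E_q; the constant term of p stays 0.\<close>
  define p where "p \<mu> = [:0, coeff (E \<mu> (u \<mu>) $ q) 0 / a q:]" for \<mu>
  show ?thesis
  proof (rule that[of p])
    have cp: "coeff (p \<mu>) j = (if j = 1 then coeff (E \<mu> (u \<mu>) $ q) 0 / a q else 0)" for \<mu> j
      by (auto simp: p_def coeff_pCons split: nat.splits)
    show "coeff_admissible (even q) i p"
      unfolding coeff_admissible_def
    proof (intro conjI allI ballI impI)
      show "(\<lambda>\<mu>. coeff (p \<mu>) j) analytic_on ball 0 R" for j
        using adm a by (cases "j = 1") (auto simp: cp coeff_admissible_def intro!: analytic_on_divide analytic_on_const)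
      fix \<mu> j assume "\<mu> \<in> ball 0 R" "coeff (p \<mu>) j \<noteq> 0"
      then have "j = 1" "even q" using adm by (auto simp: cp coeff_admissible_def split: if_splits)
      then show "even i" "j = 0 \<or> even q \<and> q * j \<le> i" using True by auto
    qed
    show "second_order_op (a i) (b i) (p \<mu>) = - (E \<mu> (u \<mu>) $ i)" if "\<mu> \<in> ball 0 R" for \<mu>
    proof (rule poly_eqI)
      fix j
      have "b i = 0" using b True \<open>i \<ge> 1\<close> by simp
      moreover have "coeff (E \<mu> (u \<mu>) $ q) j = 0" if "j \<noteq> 0" for j
        using adm that \<open>\<mu> \<in> ball 0 R\<close> by (auto simp: coeff_admissible_def)
      ultimately show "coeff (second_order_op (a i) (b i) (p \<mu>)) j = coeff (- (E \<mu> (u \<mu>) $ i)) j"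
        using a[of q] True by (cases "j = 0") (auto simp: coeff_second_order_op cp)
    qed
  qed (use True in \<open>auto simp: p_def\<close>)
qed

text \<open>The coefficient functions are picked by dependent choice along the index: step i needs
  the whole truncation below i, and \<open>next_coeff\<close> only asserts existence.\<close>

theorem normalised_solution_exists:
  obtains u where "admissible (even q) q R 0 u" "\<And>\<mu>. u \<mu> $ 0 = 0"
    "\<And>\<mu>. \<mu> \<in> ball 0 R \<Longrightarrow> E \<mu> (u \<mu>) = 0" "\<And>\<mu>. \<mu> \<in> ball 0 R \<Longrightarrow> coeff (u \<mu> $ q) 0 = 0"
proof -
  define cut where "cut f i \<mu> = Abs_fps (\<lambda>j. if j < i then f j \<mu> else 0)"
    for f :: "nat \<Rightarrow> complex \<Rightarrow> complex poly" and i \<mu>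
  define P where "P f i p \<longleftrightarrow> (i = 0 \<longrightarrow> p = (\<lambda>_. 0)) \<and> coeff_admissible (even q) i p \<and>
      (i \<ge> 1 \<longrightarrow> (\<forall>\<mu>\<in>ball 0 R. second_order_op (a i) (b i) (p \<mu>) = - (E \<mu> (cut f i \<mu>) $ i))) \<and>
      (i = q \<longrightarrow> (\<forall>\<mu>\<in>ball 0 R. coeff (p \<mu>) 0 = 0))" for f i p
  have adm_zero: "coeff_admissible (even q) i (\<lambda>_. 0)" for i
    by (simp add: coeff_admissible_def)
  have "\<exists>f. \<forall>i. P f i (f i)"
  proof (rule dependent_wellorder_choice)
    fix r and f g :: "nat \<Rightarrow> complex \<Rightarrow> complex poly" and i :: nat
    assume "\<And>y. y < i \<Longrightarrow> f y = g y"
    then have "cut f i = cut g i" by (auto simp: cut_def fun_eq_iff fps_eq_iff)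
    then show "P f i r = P g i r" by (simp add: P_def)
  next
    fix i :: nat and f :: "nat \<Rightarrow> complex \<Rightarrow> complex poly"
    assume prev: "\<And>j. j < i \<Longrightarrow> P f j (f j)"
    show "\<exists>r. P f i r"
    proof (cases "i = 0")
      case True
      then show ?thesis using q by (intro exI[of _ "\<lambda>_. 0"]) (auto simp: P_def adm_zero)
    next
      case False
      have "coeff_admissible (even q) j (\<lambda>\<mu>. cut f i \<mu> $ j)" for j
        using prev[of j] by (cases "j < i") (auto simp: cut_def P_def adm_zero)
      then have 1: "admissible (even q) q R 0 (cut f i)"
        by (simp add: admissible_iff_coeff_admissible)
      have 2: "cut f i \<mu> $ 0 = 0" for \<mu>
        using prev[of 0] False by (auto simp: cut_def P_def)
      have 3: "cut f i \<mu> $ j = 0" if "j \<ge> i" for \<mu> j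
        using that by (simp add: cut_def)
      show ?thesis
        by (rule next_coeff[OF 1 2 3, of i]) (use False in \<open>auto simp: P_def\<close>)
    qed
  qed
  then obtain f where f: "\<And>i. P f i (f i)" by blast
  define u where "u \<mu> = Abs_fps (\<lambda>i. f i \<mu>)" for \<mu>
  have u0: "u \<mu> $ 0 = 0" for \<mu>
    using f[of 0] by (simp add: P_def u_def)
  show thesis
  proof (rule that[of u])
    show "admissible (even q) q R 0 u"
      using f by (simp add: admissible_iff_coeff_admissible u_def P_def)
    show "E \<mu> (u \<mu>) = 0" if \<mu>: "\<mu> \<in> ball 0 R" for \<mu>
    proof (rule fps_ext)
      fix i
      show "E \<mu> (u \<mu>) $ i = 0 $ i"
      proof (cases "i = 0")
        case False
        have "cut f i \<mu> $ 0 = 0" using f[of 0] by (simp add: cut_def P_def)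
        \<comment> \<open>\<open>u\<close> and its truncation differ first at index i, so the i-th
          residual of \<open>u\<close> is that of the truncation plus the operator applied to the
          new coefficient.\<close>
        then have "E \<mu> (u \<mu>) $ i - E \<mu> (cut f i \<mu>) $ i =
            second_order_op (a i) (b i) (u \<mu> $ i - cut f i \<mu> $ i)"
          using False u0 \<mu> by (intro triangular) (auto simp: cut_def u_def)
        also have "u \<mu> $ i - cut f i \<mu> $ i = f i \<mu>" by (simp add: u_def cut_def)
        also have "second_order_op (a i) (b i) (f i \<mu>) = - (E \<mu> (cut f i \<mu>) $ i)"
          using f[of i] False \<mu> by (simp add: P_def)
        finally show ?thesis by simp
      qed (use E_nth_0 \<mu> u0 in simp)
    qed
    show "coeff (u \<mu> $ q) 0 = 0" if "\<mu> \<in> ball 0 R" for \<mu>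
      using f[of q] that by (simp add: P_def u_def)
  qed (rule u0)
qed

end

section \<open>Coefficients of nonlinear expressions\<close>

lemma fps_mult_nth_leading:
  fixes f g :: zseries
  assumes "\<And>j. j < i \<Longrightarrow> f $ j = 0"
  shows "(f * g) $ i = f $ i * g $ 0"
proof -
  have "(f * g) $ i = (\<Sum>j=0..i. if j = i then f $ i * g $ 0 else 0)"
    unfolding fps_mult_nth by (intro sum.cong) (auto simp: assms)
  then show ?thesis by simp
qed

lemma fps_power_nth_cong:
  fixes f g :: zseries
  assumes "\<And>j. j < i \<Longrightarrow> f $ j = g $ j" "j < i"
  shows "(f ^ k) $ j = (g ^ k) $ j"
  using assms(2)
proof (induction k arbitrary: j)
  case (Suc k)
  show ?case unfolding power_Suc by (rule fps_mult_nth_cong) (use Suc assms in auto)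
qed simp

text \<open>Linearisation of y^k at the common constant term c. Telescoping gives f^(k+1) - g^(k+1)
  = (f - g) f^k + (f^k - g^k) g, and in each product the difference, of order at least i, meets only
  a constant term.\<close>

lemma fps_power_nth_diff:
  fixes f g :: zseries
  assumes "\<And>j. j < i \<Longrightarrow> f $ j = g $ j" "f $ 0 = [:c:]" "g $ 0 = [:c:]"
  shows "(f ^ k) $ i - (g ^ k) $ i = smult (of_nat k * c ^ (k - 1)) (f $ i - g $ i)"
proof (induction k)
  case (Suc k)
  have "f ^ Suc k - g ^ Suc k = (f - g) * f ^ k + (f ^ k - g ^ k) * g"
    by (simp add: algebra_simps)
  then have "(f ^ Suc k) $ i - (g ^ Suc k) $ i = ((f - g) * f ^ k) $ i + ((f ^ k - g ^ k) * g) $ i"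
    by (metis fps_add_nth fps_sub_nth)
  also have "((f - g) * f ^ k) $ i = smult (c ^ k) (f $ i - g $ i)"
    by (subst fps_mult_nth_leading) (use assms in \<open>auto simp: fps_nth_power_0 poly_const_pow mult.commute\<close>)
  also have "((f ^ k - g ^ k) * g) $ i = smult (of_nat k * c ^ (k - 1) * c) (f $ i - g $ i)"
    by (subst fps_mult_nth_leading)
      (use assms Suc fps_power_nth_cong[of i f g] in \<open>auto simp: mult.commute\<close>)
  also have "of_nat k * c ^ (k - 1) * c = of_nat k * c ^ k"
    by (cases k) auto
  finally show ?case by (simp add: algebra_simps flip: smult_add_left)
qed simp

lemma const_series_compose_nth_diff:
  fixes u v :: zseries
  assumes "\<And>j. j < i \<Longrightarrow> u $ j = v $ j" "u $ 0 = 0" "v $ 0 = 0" "i \<ge> 1"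
  shows "(Abs_fps (\<lambda>k. [:a k:]) oo u) $ i - (Abs_fps (\<lambda>k. [:a k:]) oo v) $ i = smult (a 1) (u $ i - v $ i)"
proof -
  have "(Abs_fps (\<lambda>k. [:a k:]) oo u) $ i - (Abs_fps (\<lambda>k. [:a k:]) oo v) $ i =
      (\<Sum>k\<le>i. smult (a k) (u ^ k $ i - v ^ k $ i))"
    using assms(2,3) unfolding smult_diff_right sum_subtractf
    by (simp add: const_series_compose_nth[OF _ order_refl] fps_sum_nth)
  also have "\<dots> = (\<Sum>k\<le>i. if k = 1 then smult (a 1) (u $ i - v $ i) else 0)"
  proof (rule sum.cong[OF refl])
    fix k
    \<comment> \<open>Linearised at 0: \<open>0 ^ (k - 1)\<close> is 1 for k = 1 and 0 for k >= 2,
      and the factor \<open>of_nat k\<close> handles k = 0.\<close>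
    have "u ^ k $ i - v ^ k $ i = smult (of_nat k * 0 ^ (k - 1)) (u $ i - v $ i)"
      by (rule fps_power_nth_diff) (use assms in auto)
    then show "smult (a k) (u ^ k $ i - v ^ k $ i) = (if k = 1 then smult (a 1) (u $ i - v $ i) else 0)"
      by (cases "k = 0"; cases "k = 1") (auto simp: power_0_left)
  qed
  also have "\<dots> = smult (a 1) (u $ i - v $ i)" using assms(4) by simp
  finally show ?thesis .
qed

lemma const_series_compose_nth_cong:
  fixes u v :: zseries
  assumes "\<And>j. j < i \<Longrightarrow> u $ j = v $ j" "u $ 0 = 0" "v $ 0 = 0" "j < i"
  shows "(Abs_fps (\<lambda>k. [:a k:]) oo u) $ j = (Abs_fps (\<lambda>k. [:a k:]) oo v) $ j"
  using assms by (simp add: fps_compose_nth fps_power_nth_cong[of i u v])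

lemma fps_X2_power_nth:
  fixes f :: zseries
  shows "((fps_X ^ 2 * f) ^ k) $ i = (if i < 2 * k then 0 else (f ^ k) $ (i - 2 * k))"
proof -
  have "(fps_X ^ 2 * f) ^ k = fps_X ^ (2 * k) * f ^ k"
    by (simp only: power_mult_distrib power_mult)
  then show ?thesis by (simp only: fps_X_power_mult_nth)
qed

lemma subst_G_X2_nth:
  "subst_G g \<mu> (fps_X ^ 2 * f) $ i = (\<Sum>k\<le>i. if i < 2 * k then 0 else smult (g k \<mu>) ((f ^ k) $ (i - 2 * k)))"
  unfolding subst_G_def by (subst const_series_compose_nth[OF _ order_refl])
    (auto simp: fps_sum_nth fps_X2_power_nth intro!: sum.cong)

lemma subst_G_X2_nth_eq_0:
  assumes "\<And>k. k < N \<Longrightarrow> g k \<mu> = 0" "i < 2 * N"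
  shows "subst_G g \<mu> (fps_X ^ 2 * f) $ i = 0"
  unfolding subst_G_X2_nth by (intro sum.neutral) (use assms in auto)

text \<open>A factor w^(2k) with k >= N pushes the coefficients of f from index i on past w^m. This
  is why G contributes nothing to the linear part of step i.\<close>

lemma subst_G_X2_nth_cong:
  assumes "\<And>k. k < N \<Longrightarrow> g k \<mu> = 0" "\<And>j. j < i \<Longrightarrow> f $ j = f' $ j" "m < i + 2 * N"
  shows "subst_G g \<mu> (fps_X ^ 2 * f) $ m = subst_G g \<mu> (fps_X ^ 2 * f') $ m"
  unfolding subst_G_X2_nth
proof (intro sum.cong refl)
  fix k
  show "(if m < 2 * k then 0 else smult (g k \<mu>) ((f ^ k) $ (m - 2 * k))) =
      (if m < 2 * k then 0 else smult (g k \<mu>) ((f' ^ k) $ (m - 2 * k)))"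
    using assms fps_power_nth_cong[of i f f' "m - 2 * k" k] by (cases "k < N") auto
qed

text \<open>\<open>M\<close> is fixed by the dominant terms of the equation, while \<open>N\<close>
  comes from G: N = n + 1 against M = n for (P), N = n against M = q for (T).\<close>

lemma admissible_subst_G:
  assumes "\<And>k. g k analytic_on ball 0 R" "\<And>k \<mu>. k < N \<Longrightarrow> \<mu> \<in> ball 0 R \<Longrightarrow> g k \<mu> = 0"
    and "admissible lg q R 2 F" "\<And>\<mu>. F \<mu> $ 0 = 0" "M \<le> N"
  shows "admissible lg q R (2 * M) (\<lambda>\<mu>. subst_G g \<mu> (F \<mu>))"
proof -
  have "admissible lg q R (N * 2) (\<lambda>\<mu>. subst_G g \<mu> (F \<mu>))"
    unfolding subst_G_def by (rule admissible_compose[OF assms(1,3)]) (use assms in auto)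
  then show ?thesis by (rule admissible_mono[where d = "N - M"]) (use assms(5) in simp)
qed

lemma translate_subst_G:
  "q \<ge> 1 \<Longrightarrow> f $ 0 = 0 \<Longrightarrow> translate q c (subst_G g \<mu> f) = subst_G g \<mu> (translate q c f)"
  unfolding subst_G_def by (rule translate_compose)

lemma fps_eq_0_iff_shift:
  assumes "\<And>i. i < k \<Longrightarrow> f $ i = 0"
  shows "f = 0 \<longleftrightarrow> fps_shift k f = 0"
proof
  assume "fps_shift k f = 0"
  then have "f $ (i + k) = 0" for i by (metis fps_shift_nth fps_zero_nth)
  then have "f $ i = 0" for i using assms[of i] by (metis le_add_diff_inverse2 not_less)
  then show "f = 0" by (simp add: fps_eq_iff)
qed simp

section \<open>The polynomial case\<close>

locale inner_P =
  fixes n q :: nat and c0 :: complex and R :: real and g :: "nat \<Rightarrow> complex \<Rightarrow> complex"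
  assumes n: "n = q + 1" and q: "q \<ge> 1"
    and c0: "c0 ^ q = - (2 / of_nat q * (2 / of_nat q + 1))"
    and g_analytic: "\<And>k. g k analytic_on ball 0 R"
    and g_0: "\<And>k \<mu>. k < n + 1 \<Longrightarrow> \<mu> \<in> ball 0 R \<Longrightarrow> g k \<mu> = 0"
begin

definition solves_at :: "complex \<Rightarrow> zseries \<Rightarrow> bool" where
  "solves_at \<mu> f \<longleftrightarrow> delta2 q f = - (f ^ n) + subst_G g \<mu> f"

definition normalised_at :: "zseries \<Rightarrow> bool" where
  "normalised_at f \<longleftrightarrow> f $ 0 = 0 \<and> f $ 1 = 0 \<and> f $ 2 = [:c0:]"

definition of_correction :: "zseries \<Rightarrow> zseries" where
  "of_correction u = fps_X ^ 2 * (fps_const [:c0:] + u)"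

text \<open>Both dominant terms start at the same power: the second difference sends w^2 to
  w^(2+2q), the power starts at w^(2n), and 2n = 2 + 2q. The G part starts no earlier than
  w^(2n+2).\<close>

definition residual :: "complex \<Rightarrow> zseries \<Rightarrow> zseries" where
  "residual \<mu> u = fps_shift (2 * n) (delta2 q (of_correction u) + of_correction u ^ n - subst_G g \<mu> (of_correction u))"

lemma c0_nonzero: "c0 \<noteq> 0"
proof
  assume "c0 = 0"
  then have "2 / of_nat q * (2 / of_nat q + 1) = (0 :: complex)" using c0 q by (simp add: power_0_left)
  then have "of_nat (4 + q * 2) = (0 :: complex)" using q by (simp add: field_simps)
  then have "4 + q * 2 = 0" by (simp only: of_nat_eq_0_iff)
  then show False by simp
qed

lemma two_n: "2 * n = 2 + 2 * q"
  using n by simp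

lemma of_correction_nth: "of_correction u $ (i + 2) = (fps_const [:c0:] + u) $ i"
  by (simp add: of_correction_def fps_X_power_mult_nth)

lemma of_correction_nth_low: "i < 2 \<Longrightarrow> of_correction u $ i = 0"
  by (simp add: of_correction_def fps_X_power_mult_nth)

lemma of_correction_shift:
  assumes "normalised_at f"
  shows "of_correction (fps_shift 2 f - fps_const [:c0:]) = f"
proof (rule fps_ext)
  fix i
  show "of_correction (fps_shift 2 f - fps_const [:c0:]) $ i = f $ i"
  proof (cases "i < 2")
    case True
    then show ?thesis
      using assms by (auto simp: of_correction_nth_low normalised_at_def less_2_cases_iff)
  next
    case False
    then obtain j where "i = j + 2" by (metis add.commute le_Suc_ex not_less)
    then show ?thesis using assms by (simp only: of_correction_nth) simp
  qed
qed

lemma normalised_at_of_correction: "u $ 0 = 0 \<Longrightarrow> normalised_at (of_correction u)"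
  using of_correction_nth[of u 0] by (simp add: normalised_at_def of_correction_nth_low numeral_2_eq_2)

lemma solves_at_iff_residual:
  assumes "\<mu> \<in> ball 0 R"
  shows "solves_at \<mu> (of_correction u) \<longleftrightarrow> residual \<mu> u = 0"
proof -
  let ?f = "of_correction u"
  have "solves_at \<mu> ?f \<longleftrightarrow> delta2 q ?f + ?f ^ n - subst_G g \<mu> ?f = 0"
    by (simp add: solves_at_def eq_diff_eq)
  also have "\<dots> \<longleftrightarrow> residual \<mu> u = 0"
    unfolding residual_def
  proof (rule fps_eq_0_iff_shift)
    fix i assume i: "i < 2 * n"
    have "delta2 q ?f $ i = 0"
      by (rule delta2_nth_eq_0[where t = 2]) (use i two_n in \<open>auto simp: of_correction_nth_low\<close>)
    moreover have "?f ^ n $ i = 0"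
      using i by (simp add: of_correction_def fps_X2_power_nth)
    moreover have "subst_G g \<mu> ?f $ i = 0"
      unfolding of_correction_def
      by (rule subst_G_X2_nth_eq_0[where N = "n + 1"]) (use i g_0 assms in auto)
    ultimately show "(delta2 q ?f + ?f ^ n - subst_G g \<mu> ?f) $ i = 0" by simp
  qed
  finally show ?thesis .
qed

text \<open>With r = 2/q and s = (i + 2)/q the quadratic s(s+1) - n r(r+1) factors as (s - r - 1)(s
  + r + 2), and the second factor is positive.\<close>

lemma symbol_zero_iff:
  assumes "i \<ge> 1"
  shows "of_nat (i + 2) / of_nat q * (of_nat (i + 2) / of_nat q + 1) + of_nat n * c0 ^ q = (0 :: complex) \<longleftrightarrow> i = q"
proof -
  have nq: "of_nat q \<noteq> (0 :: complex)" using q by simp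
  have n_eq: "of_nat n = (of_nat q + 1 :: complex)" using n by simp
  have "of_nat (i + 2) / of_nat q * (of_nat (i + 2) / of_nat q + 1) + of_nat n * c0 ^ q =
      (of_nat i - of_nat q) * of_nat (i + 2 * q + 4) / (of_nat q ^ 2 :: complex)"
    unfolding c0 n_eq using nq by (simp add: divide_simps power2_eq_square) (simp add: algebra_simps)
  also have "\<dots> = 0 \<longleftrightarrow> of_nat i = (of_nat q :: complex)"
    using nq by (simp only: divide_eq_0_iff mult_eq_0_iff power_eq_0_iff of_nat_eq_0_iff) auto
  finally show ?thesis by simp
qed

text \<open>The coefficient of w^(2n) is r(r+1) c0 + c0^n with r = 2/q, which the choice of
  \<open>c0\<close> makes vanish.\<close>

lemma residual_nth_0:
  assumes "\<mu> \<in> ball 0 R" "u $ 0 = 0"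
  shows "residual \<mu> u $ 0 = 0"
proof -
  let ?f = "of_correction u"
  have "delta2 q ?f $ (2 * n) = [:2 / of_nat q * (2 / of_nat q + 1) * c0:]"
    using normalised_at_of_correction[OF assms(2)] unfolding two_n
    by (subst delta2_nth_leading) (use q in \<open>auto simp: of_correction_nth_low second_order_op_def normalised_at_def pderiv_pCons\<close>)
  moreover have "?f ^ n $ (2 * n) = [:c0 ^ n:]"
    using assms(2) by (simp add: of_correction_def fps_X2_power_nth fps_nth_power_0 poly_const_pow)
  moreover have "subst_G g \<mu> ?f $ (2 * n) = 0"
    unfolding of_correction_def
    by (rule subst_G_X2_nth_eq_0[where N = "n + 1"]) (use g_0 assms in auto)
  moreover have "c0 ^ n = c0 ^ q * c0"
    by (simp add: n)
  ultimately show ?thesis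
    by (simp add: residual_def c0)
qed

text \<open>The second difference contributes the second derivative with s = (i + 2)/q, the power
  contributes its derivative n c0^q at c0, and G contributes nothing.\<close>

lemma residual_triangular:
  assumes "\<mu> \<in> ball 0 R" "u $ 0 = 0" "v $ 0 = 0" "\<And>j. j < i \<Longrightarrow> u $ j = v $ j"
  shows "residual \<mu> u $ i - residual \<mu> v $ i =
    second_order_op (2 * of_nat (i + 2) / of_nat q + 1)
      (of_nat (i + 2) / of_nat q * (of_nat (i + 2) / of_nat q + 1) + of_nat n * c0 ^ q) (u $ i - v $ i)"
proof -
  let ?f = "of_correction u" and ?g = "of_correction v"
  have idx: "i + 2 * n = (i + 2) + 2 * q" using two_n by simp
  have "delta2 q ?f $ (i + 2 * n) - delta2 q ?g $ (i + 2 * n) = delta2 q (?f - ?g) $ ((i + 2) + 2 * q)"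
    by (simp add: delta2_diff idx)
  also have "\<dots> = second_order_op (2 * of_nat (i + 2) / of_nat q + 1)
      (of_nat (i + 2) / of_nat q * (of_nat (i + 2) / of_nat q + 1)) ((?f - ?g) $ (i + 2))"
  proof (rule delta2_nth_leading[OF _ q])
    fix j assume "j < i + 2"
    then show "(?f - ?g) $ j = 0"
      using assms(4) by (auto simp: of_correction_def fps_X_power_mult_nth)
  qed
  also have "(?f - ?g) $ (i + 2) = u $ i - v $ i"
    unfolding fps_sub_nth of_correction_nth by simp
  finally have 1: "delta2 q ?f $ (i + 2 * n) - delta2 q ?g $ (i + 2 * n) =
    second_order_op (2 * of_nat (i + 2) / of_nat q + 1)
      (of_nat (i + 2) / of_nat q * (of_nat (i + 2) / of_nat q + 1)) (u $ i - v $ i)" .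
  have "?f ^ n $ (i + 2 * n) - ?g ^ n $ (i + 2 * n) =
      (fps_const [:c0:] + u) ^ n $ i - (fps_const [:c0:] + v) ^ n $ i"
    by (simp add: of_correction_def fps_X2_power_nth)
  also have "\<dots> = smult (of_nat n * c0 ^ q) ((fps_const [:c0:] + u) $ i - (fps_const [:c0:] + v) $ i)"
    using fps_power_nth_diff[of i "fps_const [:c0:] + u" "fps_const [:c0:] + v" c0 n] assms n by simp
  finally have 2: "?f ^ n $ (i + 2 * n) - ?g ^ n $ (i + 2 * n) = smult (of_nat n * c0 ^ q) (u $ i - v $ i)"
    by simp
  have 3: "subst_G g \<mu> ?f $ (i + 2 * n) = subst_G g \<mu> ?g $ (i + 2 * n)"
    unfolding of_correction_def
    by (rule subst_G_X2_nth_cong[where N = "n + 1" and i = i]) (use g_0 assms in auto)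
  have "residual \<mu> u $ i - residual \<mu> v $ i =
      (delta2 q ?f $ (i + 2 * n) - delta2 q ?g $ (i + 2 * n)) + (?f ^ n $ (i + 2 * n) - ?g ^ n $ (i + 2 * n))"
    by (simp add: residual_def 3)
  also have "\<dots> = second_order_op (2 * of_nat (i + 2) / of_nat q + 1)
      (of_nat (i + 2) / of_nat q * (of_nat (i + 2) / of_nat q + 1) + of_nat n * c0 ^ q) (u $ i - v $ i)"
    unfolding 1 2 by (simp add: second_order_op_def smult_add_left)
  finally show ?thesis .
qed

lemma admissible_of_correction:
  "admissible lg q R 0 u \<Longrightarrow> admissible lg q R 2 (\<lambda>\<mu>. of_correction (u \<mu>))"
  unfolding of_correction_def
  using admissible_mult[OF admissible_fps_X_power[of lg q R 2] admissible_add[OF admissible_const[of "\<lambda>_. c0" R lg q]]]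
  by simp

lemma residual_admissible:
  assumes "admissible lg q R 0 u"
  shows "admissible lg q R 0 (\<lambda>\<mu>. residual \<mu> (u \<mu>))"
proof -
  note adm = admissible_of_correction[OF assms]
  have "admissible lg q R (2 * n) (\<lambda>\<mu>. delta2 q (of_correction (u \<mu>)))"
    using admissible_delta2[OF adm] by (simp add: two_n)
  moreover have "admissible lg q R (2 * n) (\<lambda>\<mu>. of_correction (u \<mu>) ^ n)"
    using admissible_power[OF adm, of n] by (simp add: mult.commute)
  moreover have "admissible lg q R (2 * n) (\<lambda>\<mu>. subst_G g \<mu> (of_correction (u \<mu>)))"
    by (rule admissible_subst_G[OF g_analytic g_0 adm]) (auto simp: of_correction_nth_low)
  ultimately show ?thesis
    unfolding residual_def by (intro admissible_shift admissible_add admissible_diff)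
qed

sublocale resonant_equation q R residual "\<lambda>i. 2 * of_nat (i + 2) / of_nat q + 1"
  "\<lambda>i. of_nat (i + 2) / of_nat q * (of_nat (i + 2) / of_nat q + 1) + of_nat n * c0 ^ q"
proof
  show "2 * of_nat (i + 2) / of_nat q + 1 \<noteq> (0 :: complex)" for i
  proof
    assume "2 * of_nat (i + 2) / of_nat q + 1 = (0 :: complex)"
    then have "of_nat (2 * (i + 2) + q) = (0 :: complex)" using q by (simp add: field_simps)
    then have "2 * (i + 2) + q = 0" by (simp only: of_nat_eq_0_iff)
    then show False by simp
  qed
qed (use q symbol_zero_iff residual_triangular residual_nth_0 residual_admissible in auto)

lemma normalised_solution_unique:
  assumes "\<mu> \<in> ball 0 R" "normalised_at f" "normalised_at h" "solves_at \<mu> f" "solves_at \<mu> h"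
    and "coeff (f $ (2 + q)) 0 = coeff (h $ (2 + q)) 0"
  shows "f = h"
proof -
  let ?u = "\<lambda>f. fps_shift 2 f - fps_const [:c0:]"
  have "?u f = ?u h"
  proof (rule solution_unique[OF assms(1)])
    show "residual \<mu> (?u f) = 0" "residual \<mu> (?u h) = 0"
      using solves_at_iff_residual[OF assms(1)] assms(2-5) by (metis of_correction_shift)+
    show "coeff (?u f $ q) 0 = coeff (?u h $ q) 0"
      using assms(6) q by (simp add: add.commute)
  qed (use assms(2,3) in \<open>simp_all add: normalised_at_def numeral_2_eq_2\<close>)
  then show ?thesis using assms(2,3) by (metis of_correction_shift)
qed

lemma normalised_solution:
  obtains \<phi> where "admissible (even q) q R 2 \<phi>" "\<And>\<mu>. normalised_at (\<phi> \<mu>)"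
    "\<And>\<mu>. \<mu> \<in> ball 0 R \<Longrightarrow> solves_at \<mu> (\<phi> \<mu>)" "\<And>\<mu>. \<mu> \<in> ball 0 R \<Longrightarrow> coeff (\<phi> \<mu> $ (2 + q)) 0 = 0"
proof -
  obtain u where u: "admissible (even q) q R 0 u" "\<And>\<mu>. u \<mu> $ 0 = 0"
    "\<And>\<mu>. \<mu> \<in> ball 0 R \<Longrightarrow> residual \<mu> (u \<mu>) = 0" "\<And>\<mu>. \<mu> \<in> ball 0 R \<Longrightarrow> coeff (u \<mu> $ q) 0 = 0"
    using normalised_solution_exists by blast
  show thesis
  proof (rule that[of "\<lambda>\<mu>. of_correction (u \<mu>)"])
    show "coeff (of_correction (u \<mu>) $ (2 + q)) 0 = 0" if "\<mu> \<in> ball 0 R" for \<mu>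
      using of_correction_nth[of "u \<mu>" q] u(4)[OF that] q by (simp add: add.commute)
  qed (use u admissible_of_correction normalised_at_of_correction solves_at_iff_residual in auto)
qed

lemma solves_at_translate:
  assumes "solves_at \<mu> f" "f $ 0 = 0"
  shows "solves_at \<mu> (translate q c f)"
  using assms q unfolding solves_at_def
  by (simp only: translate_delta2[symmetric] translate_add translate_minus translate_power translate_subst_G)

text \<open>Replacing z by z - c adds -c d/dz (c0 z^(-2/q)), that is 2 c c0 / q at w^(2+q); equating
  with the constant term of \<open>f\<close> there gives the shift.\<close>

lemma solution_is_translate:
  assumes "\<mu> \<in> ball 0 R" "normalised_at f" "normalised_at h" "solves_at \<mu> f" "solves_at \<mu> h"
    and "coeff (h $ (2 + q)) 0 = 0"
  shows "f = translate q (- (coeff (f $ (2 + q)) 0 * of_nat q / (2 * c0))) h"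
proof (rule normalised_solution_unique[OF assms(1,2) _ assms(4)])
  let ?c = "coeff (f $ (2 + q)) 0 * of_nat q / (2 * c0)"
  have low: "h $ j = 0" if "j < 2" for j
    using assms(3) that by (auto simp: normalised_at_def less_2_cases_iff)
  have "translate q (- ?c) h $ j = h $ j" if "j \<le> 2" for j
    by (rule translate_nth_low[OF low q]) (use that q in auto)
  then show "normalised_at (translate q (- ?c) h)"
    using assms(3) by (simp add: normalised_at_def)
  show "solves_at \<mu> (translate q (- ?c) h)"
    by (rule solves_at_translate[OF assms(5) low]) simp
  show "coeff (f $ (2 + q)) 0 = coeff (translate q (- ?c) h $ (2 + q)) 0"
    using assms(3,6) c0_nonzero q
    by (subst translate_nth_first_order[OF low q]) (simp_all add: normalised_at_def)
qed

end

section \<open>The trigonometric case\<close>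

locale inner_T =
  fixes n q :: nat and b :: complex and R :: real and g :: "nat \<Rightarrow> complex \<Rightarrow> complex"
  assumes n: "n = q + 1" and q: "q \<ge> 1"
    and exp_b: "exp b = - (2 / of_nat q)"
    and g_analytic: "\<And>k. g k analytic_on ball 0 R"
    and g_0: "\<And>k \<mu>. k < n \<Longrightarrow> \<mu> \<in> ball 0 R \<Longrightarrow> g k \<mu> = 0"
begin

abbreviation exp_series :: zseries where
  "exp_series \<equiv> Abs_fps (\<lambda>k. [:1 / fact k:])"

text \<open>The leading coefficient of e^phi: the exponential of \<open>phi0\<close> is
  \<open>\<beta>\<close> times w^2, and the branch \<open>b\<close> selects one q-th root of
  -2/q.\<close>

definition \<beta> :: complex where "\<beta> = exp (b / of_nat q)"

definition solves_at :: "complex \<Rightarrow> zseries \<Rightarrow> bool" where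
  "solves_at \<mu> f \<longleftrightarrow> delta2 q f = - (zexp n b f ^ q) + subst_G g \<mu> (zexp n b f)"

definition amplitude :: "zseries \<Rightarrow> zseries" where
  "amplitude u = fps_const [:\<beta>:] * (exp_series oo u)"

text \<open>The second difference of \<open>phi0\<close> and e^(q phi) both start at w^(2q), and G
  no earlier than w^(2n) = w^(2q+2).\<close>

definition residual :: "complex \<Rightarrow> zseries \<Rightarrow> zseries" where
  "residual \<mu> u = fps_shift (2 * q)
     (delta2 q (phi0 n b + u) + zexp n b (phi0 n b + u) ^ q - subst_G g \<mu> (zexp n b (phi0 n b + u)))"

lemma beta_power: "\<beta> ^ q = - (2 / of_nat q)"
  using q by (simp add: \<beta>_def exp_b flip: exp_of_nat_mult)

lemma phi0_eq: "phi0 n b = fps_const [:b / of_nat q, - 2 / of_nat q:]"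
  by (simp add: phi0_def n)

lemma zexp_eq: "zexp n b (phi0 n b + u) = fps_X ^ 2 * amplitude u"
  by (simp add: zexp_def amplitude_def \<beta>_def n mult.commute mult.left_commute)

lemma zexp_nth_0: "zexp n b f $ 0 = 0"
  by (simp add: zexp_def fps_X_power_nth)

lemma amplitude_nth_0: "amplitude u $ 0 = [:\<beta>:]"
  by (simp add: amplitude_def)

lemma amplitude_nth_diff:
  assumes "\<And>j. j < i \<Longrightarrow> u $ j = v $ j" "u $ 0 = 0" "v $ 0 = 0" "i \<ge> 1"
  shows "amplitude u $ i - amplitude v $ i = smult \<beta> (u $ i - v $ i)"
  using const_series_compose_nth_diff[OF assms, of "\<lambda>k. 1 / fact k"]
  by (simp add: amplitude_def flip: smult_diff_right)

lemma amplitude_nth_cong: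
  assumes "\<And>j. j < i \<Longrightarrow> u $ j = v $ j" "u $ 0 = 0" "v $ 0 = 0" "j < i"
  shows "amplitude u $ j = amplitude v $ j"
  using const_series_compose_nth_cong[OF assms, of "\<lambda>k. 1 / fact k"]
  by (simp add: amplitude_def)

lemma delta2_phi0_nth_low: "i < 2 * q \<Longrightarrow> delta2 q (phi0 n b) $ i = 0"
  by (rule delta2_nth_eq_0[where t = 0]) auto

lemma delta2_phi0_nth: "delta2 q (phi0 n b) $ (2 * q) = [:2 / of_nat q:]"
  using delta2_nth_leading[of 0 "phi0 n b" q] q
  by (simp add: phi0_eq second_order_op_def pderiv_pCons)

lemma solves_at_iff_residual:
  assumes "\<mu> \<in> ball 0 R" "u $ 0 = 0"
  shows "solves_at \<mu> (phi0 n b + u) \<longleftrightarrow> residual \<mu> u = 0"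
proof -
  let ?f = "phi0 n b + u"
  let ?y = "zexp n b ?f"
  have "solves_at \<mu> ?f \<longleftrightarrow> delta2 q ?f + ?y ^ q - subst_G g \<mu> ?y = 0"
    by (simp add: solves_at_def eq_diff_eq)
  also have "\<dots> \<longleftrightarrow> residual \<mu> u = 0"
    unfolding residual_def
  proof (rule fps_eq_0_iff_shift)
    fix i assume i: "i < 2 * q"
    have "delta2 q u $ i = 0"
      by (rule delta2_nth_eq_0[where t = 0]) (use i in auto)
    then have "delta2 q ?f $ i = 0"
      using delta2_phi0_nth_low[OF i] by (simp add: delta2_add)
    moreover have "?y ^ q $ i = 0"
      using i by (simp add: zexp_eq fps_X2_power_nth)
    moreover have "subst_G g \<mu> ?y $ i = 0"
      unfolding zexp_eq by (rule subst_G_X2_nth_eq_0[where N = n]) (use i g_0 assms n in auto)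
    ultimately show "(delta2 q ?f + ?y ^ q - subst_G g \<mu> ?y) $ i = 0" by simp
  qed
  finally show ?thesis .
qed

text \<open>With s = i/q the quadratic is (s - 1)(s + 2).\<close>

lemma symbol_zero_iff:
  assumes "i \<ge> 1"
  shows "of_nat i / of_nat q * (of_nat i / of_nat q + 1) - 2 = (0 :: complex) \<longleftrightarrow> i = q"
proof -
  have nq: "of_nat q \<noteq> (0 :: complex)" using q by simp
  have "of_nat i / of_nat q * (of_nat i / of_nat q + 1) - 2 =
      (of_nat i - of_nat q) * of_nat (i + 2 * q) / (of_nat q ^ 2 :: complex)"
    using nq by (simp add: divide_simps power2_eq_square) (simp add: algebra_simps)
  also have "\<dots> = 0 \<longleftrightarrow> of_nat i = (of_nat q :: complex)"
    using nq assms by (simp only: divide_eq_0_iff mult_eq_0_iff power_eq_0_iff of_nat_eq_0_iff) auto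
  finally show ?thesis by simp
qed

lemma residual_nth_0:
  assumes "\<mu> \<in> ball 0 R" "u $ 0 = 0"
  shows "residual \<mu> u $ 0 = 0"
proof -
  have "delta2 q u $ (2 * q) = 0"
    by (rule delta2_nth_eq_0[where t = 1]) (use assms in auto)
  then have "delta2 q (phi0 n b + u) $ (2 * q) = [:2 / of_nat q:]"
    by (simp add: delta2_add delta2_phi0_nth)
  moreover have "zexp n b (phi0 n b + u) ^ q $ (2 * q) = [:- (2 / of_nat q):]"
    by (simp add: zexp_eq fps_X2_power_nth fps_nth_power_0 amplitude_nth_0 poly_const_pow beta_power)
  moreover have "subst_G g \<mu> (zexp n b (phi0 n b + u)) $ (2 * q) = 0"
    unfolding zexp_eq by (rule subst_G_X2_nth_eq_0[where N = n]) (use g_0 assms n in auto)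
  ultimately show ?thesis by (simp add: residual_def)
qed

lemma residual_triangular:
  assumes "\<mu> \<in> ball 0 R" "u $ 0 = 0" "v $ 0 = 0" "i \<ge> 1" "\<And>j. j < i \<Longrightarrow> u $ j = v $ j"
  shows "residual \<mu> u $ i - residual \<mu> v $ i =
    second_order_op (2 * of_nat i / of_nat q + 1)
      (of_nat i / of_nat q * (of_nat i / of_nat q + 1) - 2) (u $ i - v $ i)"
proof -
  let ?f = "phi0 n b + u" and ?h = "phi0 n b + v"
  let ?y = "zexp n b ?f" and ?z = "zexp n b ?h"
  have "delta2 q ?f $ (i + 2 * q) - delta2 q ?h $ (i + 2 * q) = delta2 q (u - v) $ (i + 2 * q)"
    by (simp add: delta2_add delta2_diff)
  also have "\<dots> = second_order_op (2 * of_nat i / of_nat q + 1)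
      (of_nat i / of_nat q * (of_nat i / of_nat q + 1)) ((u - v) $ i)"
    by (rule delta2_nth_leading[OF _ q]) (use assms in auto)
  finally have 1: "delta2 q ?f $ (i + 2 * q) - delta2 q ?h $ (i + 2 * q) =
    second_order_op (2 * of_nat i / of_nat q + 1)
      (of_nat i / of_nat q * (of_nat i / of_nat q + 1)) (u $ i - v $ i)" by simp
  have amp: "amplitude u $ j = amplitude v $ j" if "j < i" for j
    by (rule amplitude_nth_cong[OF assms(5,2,3) that])
  have "?y ^ q $ (i + 2 * q) - ?z ^ q $ (i + 2 * q) = amplitude u ^ q $ i - amplitude v ^ q $ i"
    by (simp add: zexp_eq fps_X2_power_nth)
  also have "\<dots> = smult (of_nat q * \<beta> ^ (q - 1)) (amplitude u $ i - amplitude v $ i)"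
    by (rule fps_power_nth_diff[OF amp]) (simp_all add: amplitude_nth_0)
  also have "\<dots> = smult (of_nat q * (\<beta> ^ (q - 1) * \<beta>)) (u $ i - v $ i)"
    by (simp add: amplitude_nth_diff[OF assms(5,2,3,4)] mult.assoc)
  also have "\<beta> ^ (q - 1) * \<beta> = \<beta> ^ q"
    using q by (simp flip: power_Suc2)
  \<comment> \<open>The leading derivative of e^(q phi) is q times the q-th power of
    \<open>\<beta>\<close>; hence the constant -2 in the symbol.\<close>
  also have "of_nat q * \<beta> ^ q = - 2"
    using q by (simp add: beta_power)
  finally have 2: "?y ^ q $ (i + 2 * q) - ?z ^ q $ (i + 2 * q) = smult (- 2) (u $ i - v $ i)" .
  have 3: "subst_G g \<mu> ?y $ (i + 2 * q) = subst_G g \<mu> ?z $ (i + 2 * q)"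
    unfolding zexp_eq
    by (rule subst_G_X2_nth_cong[where N = n and i = i]) (use g_0 assms(1) amp n in auto)
  have "residual \<mu> u $ i - residual \<mu> v $ i =
      (delta2 q ?f $ (i + 2 * q) - delta2 q ?h $ (i + 2 * q)) + (?y ^ q $ (i + 2 * q) - ?z ^ q $ (i + 2 * q))"
    by (simp add: residual_def 3)
  also have "\<dots> = second_order_op (2 * of_nat i / of_nat q + 1)
      (of_nat i / of_nat q * (of_nat i / of_nat q + 1) - 2) (u $ i - v $ i)"
    unfolding 1 2 by (rule poly_eqI) (simp add: coeff_second_order_op algebra_simps)
  finally show ?thesis .
qed

lemma dz_phi0: "dz q (phi0 n b) = fps_const [:- 2 / of_nat q:] * fps_X ^ q"
  by (rule dz_eqI) (auto simp: phi0_eq fps_X_power_nth pderiv_pCons)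

text \<open>\<open>phi0\<close> has log z already at order w^0, but its derivative is the pure power
  -(2/q) w^q.\<close>

lemma admissible_delta2_phi0: "admissible lg q R (2 * q) (\<lambda>\<mu>. delta2 q (phi0 n b))"
proof -
  have "admissible lg q R (0 + q) (\<lambda>\<mu>. dz q (phi0 n b))"
    unfolding dz_phi0 using admissible_const_mult[OF _ admissible_fps_X_power[of lg q R q], of "\<lambda>_. - 2 / of_nat q"] by simp
  then show ?thesis
    using admissible_delta2_of_dz[of lg q R 0 "\<lambda>_. phi0 n b"] by simp
qed

lemma admissible_zexp:
  assumes "admissible lg q R 0 u" "\<And>\<mu>. u \<mu> $ 0 = 0"
  shows "admissible lg q R 2 (\<lambda>\<mu>. zexp n b (phi0 n b + u \<mu>))"
proof -
  have "admissible lg q R (0 * 0) (\<lambda>\<mu>. exp_series oo u \<mu>)"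
    by (rule admissible_compose[OF analytic_on_const assms(1)]) (use assms in auto)
  then have "admissible lg q R 0 (\<lambda>\<mu>. amplitude (u \<mu>))"
    unfolding amplitude_def by (intro admissible_const_mult analytic_on_const) simp
  then show ?thesis
    unfolding zexp_eq using admissible_mult[OF admissible_fps_X_power[of lg q R 2], of 0] by simp
qed

lemma residual_admissible:
  assumes "admissible lg q R 0 u" "\<And>\<mu>. u \<mu> $ 0 = 0"
  shows "admissible lg q R 0 (\<lambda>\<mu>. residual \<mu> (u \<mu>))"
proof -
  note adm = admissible_zexp[OF assms]
  have "admissible lg q R (2 * q) (\<lambda>\<mu>. delta2 q (phi0 n b + u \<mu>))"
    unfolding delta2_add using admissible_delta2[OF assms(1)]
    by (intro admissible_add admissible_delta2_phi0) simp
  moreover have "admissible lg q R (2 * q) (\<lambda>\<mu>. zexp n b (phi0 n b + u \<mu>) ^ q)"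
    using admissible_power[OF adm, of q] by (simp add: mult.commute)
  moreover have "admissible lg q R (2 * q) (\<lambda>\<mu>. subst_G g \<mu> (zexp n b (phi0 n b + u \<mu>)))"
    by (rule admissible_subst_G[OF g_analytic g_0 adm]) (simp_all add: zexp_nth_0, simp add: n)
  ultimately show ?thesis
    unfolding residual_def by (intro admissible_shift admissible_add admissible_diff)
qed

sublocale resonant_equation q R residual "\<lambda>i. 2 * of_nat i / of_nat q + 1"
  "\<lambda>i. of_nat i / of_nat q * (of_nat i / of_nat q + 1) - 2"
proof
  show "2 * of_nat i / of_nat q + 1 \<noteq> (0 :: complex)" for i
  proof
    assume "2 * of_nat i / of_nat q + 1 = (0 :: complex)"
    then have "of_nat (2 * i + q) = (0 :: complex)" using q by (simp add: field_simps)
    then have "2 * i + q = 0" by (simp only: of_nat_eq_0_iff)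
    then show False using q by simp
  qed
qed (use q symbol_zero_iff residual_triangular residual_nth_0 residual_admissible in auto)

lemma phi0_nth_q: "phi0 n b $ q = 0"
  using q by (simp add: phi0_def)

lemma normalised_solution_unique:
  assumes "\<mu> \<in> ball 0 R" "f $ 0 = phi0 n b $ 0" "h $ 0 = phi0 n b $ 0" "solves_at \<mu> f" "solves_at \<mu> h"
    and "coeff (f $ q) 0 = coeff (h $ q) 0"
  shows "f = h"
proof -
  have "f - phi0 n b = h - phi0 n b"
  proof (rule solution_unique[OF assms(1)])
    show "residual \<mu> (f - phi0 n b) = 0" "residual \<mu> (h - phi0 n b) = 0"
      using solves_at_iff_residual[OF assms(1), of "f - phi0 n b"]
        solves_at_iff_residual[OF assms(1), of "h - phi0 n b"] assms(2-5) by simp_all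
  qed (use assms phi0_nth_q in simp_all)
  then show ?thesis by simp
qed

lemma normalised_solution:
  obtains \<phi> where "admissible (even q) q R 0 (\<lambda>\<mu>. \<phi> \<mu> - phi0 n b)" "\<And>\<mu>. \<phi> \<mu> $ 0 = phi0 n b $ 0"
    "\<And>\<mu>. \<mu> \<in> ball 0 R \<Longrightarrow> solves_at \<mu> (\<phi> \<mu>)" "\<And>\<mu>. \<mu> \<in> ball 0 R \<Longrightarrow> coeff (\<phi> \<mu> $ q) 0 = 0"
proof -
  obtain u where u: "admissible (even q) q R 0 u" "\<And>\<mu>. u \<mu> $ 0 = 0"
    "\<And>\<mu>. \<mu> \<in> ball 0 R \<Longrightarrow> residual \<mu> (u \<mu>) = 0" "\<And>\<mu>. \<mu> \<in> ball 0 R \<Longrightarrow> coeff (u \<mu> $ q) 0 = 0"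
    using normalised_solution_exists by blast
  show thesis
    by (rule that[of "\<lambda>\<mu>. phi0 n b + u \<mu>"]) (use u solves_at_iff_residual phi0_nth_q in auto)
qed

text \<open>\<open>zexp\<close> is a product, so its logarithmic derivative is assembled from two
  factors: w^2 = z^(-2/q) contributes that of \<open>phi0\<close>, the formal exponential
  contributes u'.\<close>

lemma dz_zexp:
  assumes "f $ 0 = phi0 n b $ 0"
  shows "dz q (zexp n b f) = dz q f * zexp n b f"
proof -
  define u where "u = f - phi0 n b"
  have f: "f = phi0 n b + u" and u0: "u $ 0 = 0" using assms by (simp_all add: u_def)
  have "dz q (fps_X ^ 2) = fps_const [:- 2 / of_nat q:] * fps_X ^ (2 + q)"
  proof (rule dz_eqI)
    fix i
    show "(fps_const [:- 2 / of_nat q:] * fps_X ^ (2 + q)) $ (i + q) =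
        pderiv ((fps_X ^ 2 :: zseries) $ i) - smult (of_nat i / of_nat q) ((fps_X ^ 2) $ i)"
      by (auto simp: fps_X_power_nth pderiv_1)
  qed (auto simp: fps_X_power_nth)
  then have dz_X2: "dz q (fps_X ^ 2) = dz q (phi0 n b) * fps_X ^ 2"
    by (simp only: dz_phi0 power_add mult_ac)
  have "dz q (fps_X ^ 2 * (fps_const [:\<beta>:] * (exp_series oo u))) =
      (dz q (phi0 n b) + dz q u) * (fps_X ^ 2 * (fps_const [:\<beta>:] * (exp_series oo u)))"
    unfolding dz_mult dz_const dz_exp_compose[OF u0] dz_X2 by (simp add: algebra_simps)
  then show ?thesis
    by (simp only: f zexp_eq amplitude_def dz_add)
qed

text \<open>If y starts at w^t with top log coefficient l, then -(t/q) l = -(2/q) l, because h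
  starts with -(2/q) z^(-1); so t = 2, which \<open>low\<close> rules out.\<close>

lemma linear_ode_unique:
  assumes ode: "dz q y = h * y" "\<And>i. i < q \<Longrightarrow> h $ i = 0" "h $ q = [:- 2 / of_nat q:]"
    and low: "\<And>i. i \<le> 2 \<Longrightarrow> y $ i = 0"
  shows "y = 0"
proof (rule ccontr)
  assume "y \<noteq> 0"
  define t where "t = subdegree y"
  have yt: "y $ t \<noteq> 0" using \<open>y \<noteq> 0\<close> by (simp add: t_def)
  then have "t > 2" using low by (meson not_less)
  have "(h * y) $ (t + q) = (\<Sum>j=0..t + q. if j = q then h $ q * y $ t else 0)"
    unfolding fps_mult_nth
  proof (intro sum.cong refl)
    fix j assume "j \<in> {0..t + q}"
    then consider "j < q" | "j = q" | "t + q - j < t" by fastforce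
    then show "h $ j * y $ (t + q - j) = (if j = q then h $ q * y $ t else 0)"
      by cases (auto simp: ode(2) t_def nth_less_subdegree_zero)
  qed
  also have "\<dots> = smult (- 2 / of_nat q) (y $ t)" by (simp add: ode(3))
  finally have "pderiv (y $ t) - smult (of_nat t / of_nat q) (y $ t) = smult (- 2 / of_nat q) (y $ t)"
    using ode(1) dz_nth_add[of q y t] by simp
  \<comment> \<open>At the top power of log z the derivative of the polynomial drops out.\<close>
  then have "coeff (pderiv (y $ t) - smult (of_nat t / of_nat q) (y $ t)) (degree (y $ t)) =
      - 2 / of_nat q * lead_coeff (y $ t)" by simp
  then have "of_nat t = (of_nat 2 :: complex)"
    using q yt by (simp add: coeff_pderiv coeff_eq_0 field_simps)
  then show False using \<open>t > 2\<close> by (simp only: of_nat_eq_iff)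
qed

text \<open>
  Both sides solve the linear equation \<open>dy/dz = (d/dz f(z + c)) y\<close> and have the leading term
  \<open>\<beta> z\<^bsup>-2/q\<^esup>\<close>.
\<close>

lemma translate_zexp:
  assumes f0: "f $ 0 = phi0 n b $ 0"
  shows "translate q c (zexp n b f) = zexp n b (translate q c f)"
proof -
  let ?f = "translate q c f"
  have f0': "?f $ 0 = phi0 n b $ 0" using f0 q by simp
  \<comment> \<open>Translation first acts beyond the leading term at w^2, so the two exponentials
    agree up to w^2, as \<open>linear_ode_unique\<close> requires of their difference.\<close>
  have zexp_low: "zexp n b h $ i = (if i = 2 then [:\<beta>:] else 0)" if "i \<le> 2" for h i
  proof -
    have "zexp n b h = fps_X ^ 2 * amplitude (h - phi0 n b)"
      using zexp_eq[of "h - phi0 n b"] by simp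
    then show ?thesis using that by (simp add: fps_X_power_mult_nth amplitude_nth_0)
  qed
  have "translate q c (zexp n b f) - zexp n b ?f = 0"
  proof (rule linear_ode_unique[where h = "dz q ?f"])
    show "dz q (translate q c (zexp n b f) - zexp n b ?f) =
        dz q ?f * (translate q c (zexp n b f) - zexp n b ?f)"
      using q by (simp add: dz_diff dz_translate dz_zexp[OF f0] dz_zexp[OF f0'] translate_mult right_diff_distrib)
    show "dz q ?f $ q = [:- 2 / of_nat q:]"
      using dz_nth_add[of q ?f 0] f0' by (simp add: phi0_eq pderiv_pCons)
    fix i :: nat assume "i \<le> 2"
    then have "translate q c (zexp n b f) $ i = zexp n b f $ i"
      using zexp_low q by (intro translate_nth_low[where t = 2]) auto
    then show "(translate q c (zexp n b f) - zexp n b ?f) $ i = 0"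
      using zexp_low \<open>i \<le> 2\<close> by simp
  qed simp
  then show ?thesis by simp
qed

lemma solves_at_translate:
  assumes "solves_at \<mu> f" "f $ 0 = phi0 n b $ 0"
  shows "solves_at \<mu> (translate q c f)"
  using assms q unfolding solves_at_def
  by (simp only: translate_delta2[symmetric] translate_add translate_minus translate_power
      translate_subst_G zexp_nth_0 translate_zexp[symmetric])

text \<open>log(z - c) = log z - c/z + ..., so \<open>phi0\<close> gains 2c/(q z); equating
  coefficients of z^(-1) gives the shift.\<close>

lemma solution_is_translate:
  assumes "\<mu> \<in> ball 0 R" "f $ 0 = phi0 n b $ 0" "h $ 0 = phi0 n b $ 0" "solves_at \<mu> f" "solves_at \<mu> h"
    and "coeff (h $ q) 0 = 0"
  shows "f = translate q (- (coeff (f $ q) 0 * of_nat q / 2)) h"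
proof (rule normalised_solution_unique[OF assms(1,2) _ assms(4)])
  let ?c = "coeff (f $ q) 0 * of_nat q / 2"
  show "translate q (- ?c) h $ 0 = phi0 n b $ 0"
    using assms(3) q by simp
  show "solves_at \<mu> (translate q (- ?c) h)"
    by (rule solves_at_translate[OF assms(5,3)])
  show "coeff (f $ q) 0 = coeff (translate q (- ?c) h $ q) 0"
    using translate_nth_first_order[of 0 h q "- ?c"] assms(3,6) q
    by (simp add: phi0_eq pderiv_pCons)
qed

end

section \<open>Solution spaces\<close>

text \<open>The g_i are given pointwise only. Near (0, \<mu>) the double series of G can be summed
  over the powers of w - \<mu> first, which leaves a power series in y with coefficients that are
  power series in w; uniqueness of the expansion in y identifies them with g_i.\<close>

lemma nonlinearity_coeff_analytic:
  assumes "nonlinearity N \<rho> R G g" "\<rho> > 0"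
  shows "g i analytic_on ball 0 R"
  unfolding analytic_on_def
proof
  fix \<mu> :: complex assume \<mu>: "\<mu> \<in> ball (0 :: complex) R"
  have "(0, \<mu>) \<in> ball 0 \<rho> \<times> ball 0 R" using \<mu> assms(2) by simp
  moreover have "analytic2_on G (ball 0 \<rho> \<times> ball 0 R)"
    using assms(1) by (simp add: nonlinearity_def)
  ultimately obtain a e where "e > 0" and dbl: "\<forall>h k. norm h < e \<longrightarrow> norm k < e \<longrightarrow>
      ((\<lambda>(i, j). a i j * h ^ i * k ^ j) has_sum G (0 + h, \<mu> + k)) UNIV"
    unfolding analytic2_on_def by blast
  obtain d' where "d' > 0" and d': "ball \<mu> d' \<subseteq> ball 0 R"
    using \<mu> openE[OF open_ball] by blast
  define d where "d = min d' e"
  define \<epsilon> where "\<epsilon> = min e \<rho>"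
  have "\<epsilon> > 0" using \<open>e > 0\<close> assms(2) by (simp add: \<epsilon>_def)
  have "(\<lambda>j. a i j * (w - \<mu>) ^ j) sums g i w" if w: "w \<in> ball \<mu> d" for w i
  proof -
    have k: "norm (w - \<mu>) < e" and wR: "w \<in> ball 0 R"
      using w d' by (auto simp: d_def dist_norm norm_minus_commute subset_iff)
    define A where "A i = (\<Sum>\<^sub>\<infinity>j. a i j * (w - \<mu>) ^ j)" for i
    have A: "((\<lambda>j. a i j * (w - \<mu>) ^ j) has_sum A i) UNIV" for i
    proof -
      \<comment> \<open>One fixed nonzero y inside the domain suffices: cancelling y^i yields the
        summability of each row.\<close>
      have nrm: "norm (complex_of_real (\<epsilon> / 2)) < e"
        using \<open>e > 0\<close> assms(2) by (auto simp: \<epsilon>_def min_def)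
      have "(\<lambda>(i, j). a i j * complex_of_real (\<epsilon> / 2) ^ i * (w - \<mu>) ^ j) summable_on UNIV \<times> UNIV"
        using dbl nrm k unfolding summable_on_def UNIV_Times_UNIV by blast
      then have "(\<lambda>j. a i j * complex_of_real (\<epsilon> / 2) ^ i * (w - \<mu>) ^ j) summable_on UNIV"
        by (rule summable_on_SigmaD1) auto
      also have "(\<lambda>j. a i j * complex_of_real (\<epsilon> / 2) ^ i * (w - \<mu>) ^ j) =
          (\<lambda>j. complex_of_real (\<epsilon> / 2) ^ i * (a i j * (w - \<mu>) ^ j))"
        by (simp add: mult_ac)
      finally have "(\<lambda>j. a i j * (w - \<mu>) ^ j) summable_on UNIV"
        using \<open>\<epsilon> > 0\<close> by (subst (asm) summable_on_cmult_right') auto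
      then show ?thesis unfolding A_def by (rule has_sum_infsum)
    qed
    have A_sums: "(\<lambda>i. A i * h ^ i) sums G (h, w)" if "norm h < \<epsilon>" for h
    proof (rule has_sum_imp_sums, rule has_sum_SigmaD[where B = "\<lambda>_. UNIV" and A = UNIV])
      show "((\<lambda>(i, j). a i j * h ^ i * (w - \<mu>) ^ j) has_sum G (h, w)) (UNIV \<times> UNIV)"
        using dbl[rule_format, of h, OF _ k] that by (simp add: \<epsilon>_def)
      show "((\<lambda>j. case (i, j) of (i, j) \<Rightarrow> a i j * h ^ i * (w - \<mu>) ^ j) has_sum A i * h ^ i) UNIV" for i
        using has_sum_cmult_left[OF A[of i], of "h ^ i"] by (simp add: mult_ac)
    qed
    have g_sums: "(\<lambda>i. g i w * h ^ i) sums G (h, w)" if "norm h < \<epsilon>" for h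
      using assms(1) that wR by (simp add: nonlinearity_def \<epsilon>_def)
    have ev: "\<forall>\<^sub>F h :: complex in nhds 0. norm h < \<epsilon>"
      using eventually_nhds_in_open[of "ball (0 :: complex) \<epsilon>" 0] \<open>\<epsilon> > 0\<close> by simp
    have "(\<lambda>h. G (h, w)) has_fps_expansion Abs_fps A"
      by (rule has_fps_expansionI) (use ev A_sums in \<open>auto elim!: eventually_mono\<close>)
    moreover have "(\<lambda>h. G (h, w)) has_fps_expansion Abs_fps (\<lambda>i. g i w)"
      by (rule has_fps_expansionI) (use ev g_sums in \<open>auto elim!: eventually_mono\<close>)
    ultimately have "Abs_fps A = Abs_fps (\<lambda>i. g i w)"
      by (rule fps_expansion_unique_complex)
    then have "A i = g i w" by (simp add: fps_eq_iff)
    with A[of i] show ?thesis by (auto intro: has_sum_imp_sums)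
  qed
  then have "g i holomorphic_on ball \<mu> d" by (rule power_series_holomorphic)
  moreover have "d > 0" using \<open>d' > 0\<close> \<open>e > 0\<close> by (simp add: d_def)
  ultimately show "\<exists>e>0. g i holomorphic_on ball \<mu> e" by blast
qed

text \<open>A disc is connected, so a continuous function with finitely many values is constant.
  Applied to the leading coefficient, confined to a finite set of values, this makes it independent
  of \<mu>.\<close>

lemma analytic_finite_range_constant:
  assumes "f analytic_on ball (0 :: complex) R" "\<And>\<mu>. \<mu> \<in> ball 0 R \<Longrightarrow> f \<mu> \<in> A" "finite A"
  obtains c where "\<And>\<mu>. \<mu> \<in> ball 0 R \<Longrightarrow> f \<mu> = c"
proof -
  have "f constant_on ball 0 R"
    by (rule continuous_finite_range_constant)
      (use assms in \<open>auto intro: analytic_imp_holomorphic holomorphic_on_imp_continuous_on finite_subset[of _ A]\<close>)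
  with that show thesis unfolding constant_on_def by blast
qed

section \<open>Between spaces of formal solutions and admissible families\<close>

lemma power_spaceD:
  assumes "\<phi> \<in> power_space s R"
  shows "\<mu> \<in> ball 0 R \<Longrightarrow> \<phi> \<mu> $ 0 = 0"
    and "\<mu> \<in> ball 0 R \<Longrightarrow> \<exists>c. \<phi> \<mu> $ i = [:c:]"
    and "\<mu> \<in> ball 0 R \<Longrightarrow> \<not> s dvd i \<Longrightarrow> \<phi> \<mu> $ i = 0"
    and "(\<lambda>\<mu>. coeff (\<phi> \<mu> $ i) j) analytic_on ball 0 R"
proof -
  obtain c where c: "\<And>k. c k analytic_on ball 0 R" and \<phi>: "\<And>\<mu>. \<mu> \<in> ball 0 R \<Longrightarrow>
      \<phi> \<mu> = Abs_fps (\<lambda>i. if 0 < i \<and> s dvd i then [:c (i div s - 1) \<mu>:] else 0)"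
    using assms unfolding power_space_def by blast
  show "\<mu> \<in> ball 0 R \<Longrightarrow> \<phi> \<mu> $ 0 = 0" "\<mu> \<in> ball 0 R \<Longrightarrow> \<exists>c. \<phi> \<mu> $ i = [:c:]"
    "\<mu> \<in> ball 0 R \<Longrightarrow> \<not> s dvd i \<Longrightarrow> \<phi> \<mu> $ i = 0"
    by (auto simp: \<phi>)
  have an: "(\<lambda>\<mu>. if 0 < i \<and> s dvd i \<and> j = 0 then c (i div s - 1) \<mu> else 0) analytic_on ball 0 R"
    using c by (cases "0 < i \<and> s dvd i \<and> j = 0") (simp_all only: if_True if_False simp_thms analytic_on_const)
  show "(\<lambda>\<mu>. coeff (\<phi> \<mu> $ i) j) analytic_on ball 0 R"
    by (rule analytic_on_ball_cong[OF an]) (auto simp: \<phi> coeff_pCons split: nat.splits)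
qed

lemma log_spaceD:
  assumes "\<phi> \<in> log_space d R"
  shows "\<mu> \<in> ball 0 R \<Longrightarrow> \<phi> \<mu> $ 0 = 0"
    and "\<mu> \<in> ball 0 R \<Longrightarrow> odd i \<Longrightarrow> \<phi> \<mu> $ i = 0"
    and "\<mu> \<in> ball 0 R \<Longrightarrow> j > d (i div 2) \<Longrightarrow> coeff (\<phi> \<mu> $ i) j = 0"
    and "(\<lambda>\<mu>. coeff (\<phi> \<mu> $ i) j) analytic_on ball 0 R"
proof -
  obtain c where c: "\<And>k j. c k j analytic_on ball 0 R" and \<phi>: "\<And>\<mu>. \<mu> \<in> ball 0 R \<Longrightarrow>
      \<phi> \<mu> = Abs_fps (\<lambda>i. if 0 < i \<and> 2 dvd i then (\<Sum>j\<le>d (i div 2). monom (c (i div 2 - 1) j \<mu>) j) else 0)"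
    using assms unfolding log_space_def by blast
  have coeff: "coeff (\<phi> \<mu> $ i) j =
      (if 0 < i \<and> even i \<and> j \<le> d (i div 2) then c (i div 2 - 1) j \<mu> else 0)" if "\<mu> \<in> ball 0 R" for \<mu> i j
    by (simp add: \<phi>[OF that] coeff_sum)
  show "\<mu> \<in> ball 0 R \<Longrightarrow> \<phi> \<mu> $ 0 = 0" "\<mu> \<in> ball 0 R \<Longrightarrow> odd i \<Longrightarrow> \<phi> \<mu> $ i = 0"
    "\<mu> \<in> ball 0 R \<Longrightarrow> j > d (i div 2) \<Longrightarrow> coeff (\<phi> \<mu> $ i) j = 0"
    using coeff by (auto simp: poly_eq_iff)
  have an: "(\<lambda>\<mu>. if 0 < i \<and> even i \<and> j \<le> d (i div 2) then c (i div 2 - 1) j \<mu> else 0) analytic_on ball 0 R"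
    using c by (cases "0 < i \<and> even i \<and> j \<le> d (i div 2)") (simp_all only: if_True if_False simp_thms analytic_on_const)
  show "(\<lambda>\<mu>. coeff (\<phi> \<mu> $ i) j) analytic_on ball 0 R"
    by (rule analytic_on_ball_cong[OF an]) (simp add: coeff)
qed

text \<open>Hypothesis \<open>d\<close> converts the log budget, counted from w^a, into the degree
  bound that the space imposes at w^(2k).\<close>

lemma admissible_imp_log_space:
  assumes adm: "admissible lg q R a F" and "even a" and "\<And>\<mu>. \<mu> \<in> ball 0 R \<Longrightarrow> F \<mu> $ 0 = 0"
    and d: "\<And>k j. a + q * j \<le> 2 * k \<Longrightarrow> j \<le> d k"
  shows "F \<in> log_space d R"
  unfolding log_space_def mem_Collect_eq
proof (intro exI conjI allI ballI)
  \<comment> \<open>The index shift of the space: its k-th coefficient functions sit at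
    w^(2(k+1)).\<close>
  show "(\<lambda>\<mu>. coeff (F \<mu> $ (2 * (k + 1))) j) analytic_on ball 0 R" for k j
    by (rule admissible_analytic[OF adm])
  fix \<mu> :: complex assume \<mu>: "\<mu> \<in> ball 0 R"
  show "F \<mu> = Abs_fps (\<lambda>i. if 0 < i \<and> 2 dvd i
      then (\<Sum>j\<le>d (i div 2). monom (coeff (F \<mu> $ (2 * (i div 2 - 1 + 1))) j) j) else 0)"
  proof (rule fps_ext, rule poly_eqI)
    fix i j :: nat
    have idx: "2 * (i div 2 - 1 + 1) = i" if "0 < i \<and> 2 dvd i"
      using that by (auto elim!: evenE)
    have "even i \<and> j \<le> d (i div 2)" if nz: "coeff (F \<mu> $ i) j \<noteq> 0"
    proof -
      obtain k where k: "i = a + 2 * k" "j = 0 \<or> lg \<and> q * j \<le> 2 * k"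
        using admissible_support[OF adm \<mu> nz] by blast
      then have "even i" using \<open>even a\<close> by simp
      moreover have "a + q * j \<le> 2 * (i div 2)" using k \<open>even i\<close> by auto
      ultimately show ?thesis using d by blast
    qed
    moreover have "i \<noteq> 0" if "coeff (F \<mu> $ i) j \<noteq> 0"
      using that assms(3)[OF \<mu>] by (cases "i = 0") auto
    ultimately show "coeff (F \<mu> $ i) j = coeff (Abs_fps (\<lambda>i. if 0 < i \<and> 2 dvd i
      then (\<Sum>j\<le>d (i div 2). monom (coeff (F \<mu> $ (2 * (i div 2 - 1 + 1))) j) j) else 0) $ i) j"
      using idx by (cases "0 < i \<and> 2 dvd i") (auto simp: coeff_sum simp del: One_nat_def add_Suc_right add_0_right)
  qed
qed

lemma admissible_imp_power_space:
  assumes adm: "admissible False q R a F" and "even a" and "\<And>\<mu>. \<mu> \<in> ball 0 R \<Longrightarrow> F \<mu> $ 0 = 0"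
  shows "F \<in> power_space 2 R"
  unfolding power_space_def mem_Collect_eq
proof (intro exI conjI allI ballI)
  show "(\<lambda>\<mu>. coeff (F \<mu> $ (2 * (k + 1))) 0) analytic_on ball 0 R" for k
    by (rule admissible_analytic[OF adm])
  fix \<mu> :: complex assume \<mu>: "\<mu> \<in> ball 0 R"
  show "F \<mu> = Abs_fps (\<lambda>i. if 0 < i \<and> 2 dvd i then [:coeff (F \<mu> $ (2 * (i div 2 - 1 + 1))) 0:] else 0)"
  proof (rule fps_ext, rule poly_eqI)
    fix i j :: nat
    have idx: "2 * (i div 2 - 1 + 1) = i" if "0 < i \<and> 2 dvd i"
      using that by (auto elim!: evenE)
    have "even i \<and> j = 0" if nz: "coeff (F \<mu> $ i) j \<noteq> 0"
    proof -
      obtain k where "i = a + 2 * k" "j = 0 \<or> False \<and> q * j \<le> 2 * k"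
        using admissible_support[OF adm \<mu> nz] by blast
      then show ?thesis using \<open>even a\<close> by simp
    qed
    moreover have "i \<noteq> 0" if "coeff (F \<mu> $ i) j \<noteq> 0"
      using that assms(3)[OF \<mu>] by (cases "i = 0") auto
    ultimately show "coeff (F \<mu> $ i) j =
        coeff (Abs_fps (\<lambda>i. if 0 < i \<and> 2 dvd i then [:coeff (F \<mu> $ (2 * (i div 2 - 1 + 1))) 0:] else 0) $ i) j"
      using idx by (cases "0 < i \<and> 2 dvd i") (auto simp: coeff_pCons simp del: One_nat_def add_Suc_right add_0_right split: nat.splits)
  qed
qed

lemma exactly_oneI:
  assumes "\<phi> \<in> S" "\<And>\<psi> \<mu>. \<psi> \<in> S \<Longrightarrow> \<mu> \<in> ball 0 R \<Longrightarrow> \<psi> \<mu> = \<phi> \<mu>"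
  shows "exactly_one R S"
  using assms unfolding exactly_one_def by blast

section \<open>Normalised families in the polynomial case\<close>

context inner_P
begin

text \<open>The conditions that uniqueness uses, phrased alike for both parities of n; for even n
  the last one holds in \<open>P_even\<close> by parity.\<close>

definition normalised_solution_family :: "(complex \<Rightarrow> zseries) \<Rightarrow> bool" where
  "normalised_solution_family \<phi> \<longleftrightarrow> (\<forall>\<mu>\<in>ball 0 R.
     normalised_at (\<phi> \<mu>) \<and> solves_at \<mu> (\<phi> \<mu>) \<and> coeff (\<phi> \<mu> $ (2 + q)) 0 = 0)"

lemma n_diff [simp]: "n - Suc 0 = q"
  by (simp add: n)

lemma solves_P_iff: "solves_P n R g \<phi> \<longleftrightarrow> (\<forall>\<mu>\<in>ball 0 R. solves_at \<mu> (\<phi> \<mu>))"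
  by (simp add: solves_P_def solves_at_def)

lemma exactly_one_normalised_solution:
  assumes "\<And>\<phi>. \<phi> \<in> S \<Longrightarrow> normalised_solution_family \<phi>"
    and "\<And>\<phi>. admissible (even q) q R 2 \<phi> \<Longrightarrow> normalised_solution_family \<phi> \<Longrightarrow> \<phi> \<in> S"
  shows "exactly_one R S"
proof -
  obtain \<phi> where \<phi>: "admissible (even q) q R 2 \<phi>" "normalised_solution_family \<phi>"
    using normalised_solution unfolding normalised_solution_family_def by metis
  show ?thesis
  proof (rule exactly_oneI[of \<phi>])
    show "\<phi> \<in> S" by (rule assms(2)[OF \<phi>])
    fix \<psi> and \<mu> :: complex assume "\<psi> \<in> S" "\<mu> \<in> ball 0 R"
    then show "\<psi> \<mu> = \<phi> \<mu>"
      using \<phi>(2) assms(1)[of \<psi>] normalised_solution_unique[of \<mu> "\<psi> \<mu>" "\<phi> \<mu>"]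
      unfolding normalised_solution_family_def by simp
  qed
qed

text \<open>The shift is a constant multiple of the coefficient of \<open>\<chi>\<close> at w^(2+q),
  and so analytic in \<mu>.\<close>

lemma translate_of_normalised_solution:
  assumes "\<And>\<phi>. admissible (even q) q R 2 \<phi> \<Longrightarrow> normalised_solution_family \<phi> \<Longrightarrow> \<phi> \<in> S"
    and "\<And>\<mu>. \<mu> \<in> ball 0 R \<Longrightarrow> normalised_at (\<chi> \<mu>)" "solves_P n R g \<chi>"
    and an: "(\<lambda>\<mu>. coeff (\<chi> \<mu> $ (2 + q)) 0) analytic_on ball 0 R"
  shows "\<exists>\<psi>\<in>S. translate_of n R \<chi> \<psi>"
proof -
  obtain \<phi> where \<phi>: "admissible (even q) q R 2 \<phi>" "normalised_solution_family \<phi>"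
    using normalised_solution unfolding normalised_solution_family_def by metis
  have "translate_of n R \<chi> \<phi>"
    unfolding translate_of_def
  proof (intro exI conjI ballI)
    show "(\<lambda>\<mu>. coeff (\<chi> \<mu> $ (2 + q)) 0 * of_nat q / (2 * c0)) analytic_on ball 0 R"
      using c0_nonzero by (intro analytic_on_divide analytic_on_mult an analytic_on_const) simp
    fix \<mu> :: complex assume "\<mu> \<in> ball 0 R"
    then show "\<chi> \<mu> = translate (n - 1) (- (coeff (\<chi> \<mu> $ (2 + q)) 0 * of_nat q / (2 * c0))) (\<phi> \<mu>)"
      using solution_is_translate[of \<mu> "\<chi> \<mu>" "\<phi> \<mu>"] \<phi>(2) assms(2,3)
      unfolding normalised_solution_family_def solves_P_iff by simp
  qed
  with assms(1)[OF \<phi>] show ?thesis by blast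
qed

lemma P_even_normalised:
  assumes "even n" "\<phi> \<in> P_even n R g c0"
  shows "normalised_solution_family \<phi>"
  unfolding normalised_solution_family_def
proof (intro ballI conjI)
  fix \<mu> :: complex assume \<mu>: "\<mu> \<in> ball 0 R"
  from assms(2) have sp: "\<phi> \<in> power_space 2 R" and "zcoeff \<phi> 0 0 \<mu> = c0" and sol: "solves_P n R g \<phi>"
    using \<mu> by (auto simp: P_even_def)
  then have "coeff (\<phi> \<mu> $ 2) 0 = c0" by (simp add: zcoeff_def numeral_2_eq_2)
  moreover obtain c where "\<phi> \<mu> $ 2 = [:c:]" using power_spaceD(2)[OF sp \<mu>] by blast
  ultimately show "normalised_at (\<phi> \<mu>)"
    using power_spaceD(1)[OF sp \<mu>] power_spaceD(3)[OF sp \<mu>, of 1] by (simp add: normalised_at_def)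
  show "solves_at \<mu> (\<phi> \<mu>)" using sol \<mu> by (simp add: solves_P_iff)
  \<comment> \<open>2 + q is odd, while the space contains only even powers of w.\<close>
  have "\<phi> \<mu> $ (2 + q) = 0" using assms(1) n by (intro power_spaceD(3)[OF sp \<mu>]) auto
  then show "coeff (\<phi> \<mu> $ (2 + q)) 0 = 0" by simp
qed

lemma normalised_in_P_even:
  assumes "even n" "admissible (even q) q R 2 \<phi>" "normalised_solution_family \<phi>"
  shows "\<phi> \<in> P_even n R g c0"
proof -
  have "odd q" using assms(1) n by simp
  then have "\<phi> \<in> power_space 2 R"
    using admissible_imp_power_space[of q R 2 \<phi>] assms
    by (simp add: normalised_solution_family_def normalised_at_def)
  then show ?thesis
    using assms(3) by (auto simp: P_even_def solves_P_iff normalised_solution_family_def normalised_at_def zcoeff_def numeral_2_eq_2)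
qed

lemma normalised_at_log_space:
  assumes "m \<ge> 2" "\<phi> \<in> log_space (\<lambda>k. (k - 1) div (m - 1)) R" "\<mu> \<in> ball 0 R" "zcoeff \<phi> 0 0 \<mu> = c0"
  shows "normalised_at (\<phi> \<mu>)"
proof -
  have "coeff (\<phi> \<mu> $ 2) 0 = c0" using assms(4) by (simp add: zcoeff_def numeral_2_eq_2)
  moreover have "coeff (\<phi> \<mu> $ 2) j = 0" if "j > 0" for j
    by (rule log_spaceD(3)[OF assms(2,3)]) (use that in simp)
  ultimately have "\<phi> \<mu> $ 2 = [:c0:]"
    by (auto simp: poly_eq_iff coeff_pCons split: nat.splits)
  then show ?thesis
    using log_spaceD(1)[OF assms(2,3)] log_spaceD(2)[OF assms(2,3), of 1] by (simp add: normalised_at_def)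
qed

lemma P_odd_normalised:
  assumes "m \<ge> 2" "n = 2 * m - 1" "\<phi> \<in> P_odd n m R g c0"
  shows "normalised_solution_family \<phi>"
proof -
  \<comment> \<open>z^(-mr) = w^(2m) and 2m = n + 1 = q + 2: the normalised coefficient is the
    resonant one.\<close>
  have "2 * (m - 1 + 1) = 2 + q" using assms(1,2) n by simp
  then have "zcoeff \<phi> (m - 1) 0 \<mu> = coeff (\<phi> \<mu> $ (2 + q)) 0" for \<mu>
    by (simp only: zcoeff_def)
  then show ?thesis
    using normalised_at_log_space[OF assms(1), of \<phi>] assms(3)
    by (simp add: normalised_solution_family_def P_odd_def solves_P_iff)
qed

lemma normalised_in_P_odd:
  assumes "m \<ge> 2" "n = 2 * m - 1" "admissible (even q) q R 2 \<phi>" "normalised_solution_family \<phi>"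
  shows "\<phi> \<in> P_odd n m R g c0"
proof -
  have idx: "2 * (m - 1 + 1) = 2 + q" and q_eq: "q = 2 * (m - 1)" using assms(1,2) n by auto
  have "\<phi> \<in> log_space (\<lambda>k. (k - 1) div (m - 1)) R"
  proof (rule admissible_imp_log_space[OF assms(3)])
    show "j \<le> (k - 1) div (m - 1)" if "2 + q * j \<le> 2 * k" for k j
      using that assms(1) by (simp add: q_eq less_eq_div_iff_mult_less_eq mult.commute)
  qed (use assms(4) in \<open>auto simp: normalised_solution_family_def normalised_at_def\<close>)
  then show ?thesis
    using assms(4) idx
    by (auto simp: P_odd_def solves_P_iff normalised_solution_family_def normalised_at_def zcoeff_def numeral_2_eq_2)
qed

end

section \<open>Normalised families in the trigonometric case\<close>

context inner_T
begin

definition normalised_solution_family :: "(complex \<Rightarrow> zseries) \<Rightarrow> bool" where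
  "normalised_solution_family \<phi> \<longleftrightarrow> (\<forall>\<mu>\<in>ball 0 R.
     \<phi> \<mu> $ 0 = phi0 n b $ 0 \<and> solves_at \<mu> (\<phi> \<mu>) \<and> coeff (\<phi> \<mu> $ q) 0 = 0)"

lemma n_diff [simp]: "n - Suc 0 = q"
  by (simp add: n)

lemma solves_T_iff: "solves_T n b R g \<phi> \<longleftrightarrow> (\<forall>\<mu>\<in>ball 0 R. solves_at \<mu> (\<phi> \<mu>))"
  by (simp add: solves_T_def solves_at_def)

lemma exactly_one_normalised_solution:
  assumes "\<And>\<phi>. \<phi> \<in> S \<Longrightarrow> normalised_solution_family \<phi>"
    and "\<And>\<phi>. admissible (even q) q R 0 (\<lambda>\<mu>. \<phi> \<mu> - phi0 n b) \<Longrightarrow> normalised_solution_family \<phi> \<Longrightarrow> \<phi> \<in> S"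
  shows "exactly_one R S"
proof -
  obtain \<phi> where \<phi>: "admissible (even q) q R 0 (\<lambda>\<mu>. \<phi> \<mu> - phi0 n b)" "normalised_solution_family \<phi>"
    using normalised_solution unfolding normalised_solution_family_def by metis
  show ?thesis
  proof (rule exactly_oneI[of \<phi>])
    show "\<phi> \<in> S" by (rule assms(2)[OF \<phi>])
    fix \<psi> and \<mu> :: complex assume "\<psi> \<in> S" "\<mu> \<in> ball 0 R"
    then show "\<psi> \<mu> = \<phi> \<mu>"
      using \<phi>(2) assms(1)[of \<psi>] normalised_solution_unique[of \<mu> "\<psi> \<mu>" "\<phi> \<mu>"]
      unfolding normalised_solution_family_def by simp
  qed
qed

lemma translate_of_normalised_solution:
  assumes "\<And>\<phi>. admissible (even q) q R 0 (\<lambda>\<mu>. \<phi> \<mu> - phi0 n b) \<Longrightarrow> normalised_solution_family \<phi> \<Longrightarrow> \<phi> \<in> S"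
    and "\<And>\<mu>. \<mu> \<in> ball 0 R \<Longrightarrow> (\<chi> \<mu> - phi0 n b) $ 0 = 0" "solves_T n b R g \<chi>"
    and "(\<lambda>\<mu>. coeff ((\<chi> \<mu> - phi0 n b) $ q) 0) analytic_on ball 0 R"
  shows "\<exists>\<psi>\<in>S. translate_of n R \<chi> \<psi>"
proof -
  obtain \<phi> where \<phi>: "admissible (even q) q R 0 (\<lambda>\<mu>. \<phi> \<mu> - phi0 n b)" "normalised_solution_family \<phi>"
    using normalised_solution unfolding normalised_solution_family_def by metis
  have an: "(\<lambda>\<mu>. coeff (\<chi> \<mu> $ q) 0) analytic_on ball 0 R"
    using assms(4) by (simp add: phi0_nth_q)
  have "translate_of n R \<chi> \<phi>"
    unfolding translate_of_def
  proof (intro exI conjI ballI)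
    show "(\<lambda>\<mu>. coeff (\<chi> \<mu> $ q) 0 * of_nat q / 2) analytic_on ball 0 R"
      by (intro analytic_on_divide analytic_on_mult an analytic_on_const) simp
    fix \<mu> :: complex assume "\<mu> \<in> ball 0 R"
    then show "\<chi> \<mu> = translate (n - 1) (- (coeff (\<chi> \<mu> $ q) 0 * of_nat q / 2)) (\<phi> \<mu>)"
      using solution_is_translate[of \<mu> "\<chi> \<mu>" "\<phi> \<mu>"] \<phi>(2) assms(2)[of \<mu>] assms(3)
      unfolding normalised_solution_family_def solves_T_iff by simp
  qed
  with assms(1)[OF \<phi>] show ?thesis by blast
qed

lemma T_even_normalised:
  assumes "even n" "\<phi> \<in> T_even n R g b"
  shows "normalised_solution_family \<phi>"
  unfolding normalised_solution_family_def
proof (intro ballI conjI)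
  fix \<mu> :: complex assume \<mu>: "\<mu> \<in> ball 0 R"
  from assms(2) have sp: "(\<lambda>\<mu>. \<phi> \<mu> - phi0 n b) \<in> power_space 2 R" and sol: "solves_T n b R g \<phi>"
    by (auto simp: T_even_def)
  show "\<phi> \<mu> $ 0 = phi0 n b $ 0" using power_spaceD(1)[OF sp \<mu>] by simp
  show "solves_at \<mu> (\<phi> \<mu>)" using sol \<mu> by (simp add: solves_T_iff)
  have "(\<phi> \<mu> - phi0 n b) $ q = 0" using assms(1) n by (intro power_spaceD(3)[OF sp \<mu>]) auto
  then show "coeff (\<phi> \<mu> $ q) 0 = 0" by (simp add: phi0_nth_q)
qed

lemma normalised_in_T_even:
  assumes "even n" "admissible (even q) q R 0 (\<lambda>\<mu>. \<phi> \<mu> - phi0 n b)" "normalised_solution_family \<phi>"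
  shows "\<phi> \<in> T_even n R g b"
proof -
  have "odd q" using assms(1) n by simp
  have "(\<lambda>\<mu>. \<phi> \<mu> - phi0 n b) \<in> power_space 2 R"
    using admissible_imp_power_space[of q R 0 "\<lambda>\<mu>. \<phi> \<mu> - phi0 n b"] assms \<open>odd q\<close>
    by (simp add: normalised_solution_family_def)
  then show ?thesis
    using assms(3) by (auto simp: T_even_def solves_T_iff normalised_solution_family_def)
qed

lemma T_odd_normalised:
  assumes "m \<ge> 2" "n = 2 * m - 1" "\<phi> \<in> T_odd n m R g b"
  shows "normalised_solution_family \<phi>"
proof -
  have idx: "2 * (m - 2 + 1) = q" using assms(1,2) n by simp
  from assms(3) have sp: "(\<lambda>\<mu>. \<phi> \<mu> - phi0 n b) \<in> log_space (\<lambda>k. k div (m - 1)) R"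
    by (simp add: T_odd_def)
  show ?thesis
    using log_spaceD(1)[OF sp] assms(3) idx
    by (auto simp: normalised_solution_family_def T_odd_def solves_T_iff zcoeff_def)
qed

lemma normalised_in_T_odd:
  assumes "m \<ge> 2" "n = 2 * m - 1" "admissible (even q) q R 0 (\<lambda>\<mu>. \<phi> \<mu> - phi0 n b)" "normalised_solution_family \<phi>"
  shows "\<phi> \<in> T_odd n m R g b"
proof -
  have idx: "2 * (m - 2 + 1) = q" and q_eq: "q = 2 * (m - 1)" using assms(1,2) n by auto
  have "(\<lambda>\<mu>. \<phi> \<mu> - phi0 n b) \<in> log_space (\<lambda>k. k div (m - 1)) R"
  proof (rule admissible_imp_log_space[OF assms(3)])
    show "j \<le> k div (m - 1)" if "0 + q * j \<le> 2 * k" for k j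
      using that assms(1) by (simp add: q_eq less_eq_div_iff_mult_less_eq mult.commute)
  qed (use assms(4) in \<open>auto simp: normalised_solution_family_def\<close>)
  then show ?thesis
    using assms(4) idx
    by (auto simp: T_odd_def solves_T_iff normalised_solution_family_def zcoeff_def)
qed

end

text \<open>
  Balance of the leading powers: for \<open>f = c z\<^bsup>-t/q\<^esup> + \<dots>\<close> the two sides of (P) start with
  \<open>z\<^bsup>-t/q - 2\<^esup>\<close> and \<open>z\<^bsup>-nt/q\<^esup>\<close>, whence \<open>t = 2\<close>.
\<close>

lemma solution_P_leading_coeff:
  assumes n: "n = q + 1" and q: "q \<ge> 1" and g_0: "\<And>k. k < n + 1 \<Longrightarrow> g k \<mu> = 0"
    and f: "f $ 0 = 0" "f \<noteq> 0" "\<And>i. \<exists>c. f $ i = [:c:]"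
    and eq: "delta2 q f = - (f ^ n) + subst_G g \<mu> f"
  shows "f $ 1 = 0" "\<exists>c. f $ 2 = [:c:] \<and> c ^ q = - (2 / of_nat q * (2 / of_nat q + 1))"
proof -
  define t where "t = subdegree f"
  obtain c where c: "f $ t = [:c:]" using f(3) by blast
  have "c \<noteq> 0" using c f(2) by (metis nth_subdegree_zero_iff pCons_0_0 t_def)
  have low: "f $ j = 0" if "j < t" for j
    using that by (simp add: t_def nth_less_subdegree_zero)
  have "t \<ge> 1" using f(1) c \<open>c \<noteq> 0\<close> by (cases "t = 0") auto
  have power_low: "f ^ k $ i = 0" if "i < k * t" for i k
    using that by (intro nth_less_subdegree_zero) (simp add: t_def)
  have G_low: "subst_G g \<mu> f $ i = 0" if "i < (n + 1) * t" for i
    unfolding subst_G_def const_series_compose_nth[OF f(1) order_refl] fps_sum_nth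
  proof (intro sum.neutral ballI)
    fix k
    show "(fps_const [:g k \<mu>:] * f ^ k) $ i = 0"
    proof (cases "k < n + 1")
      case False
      then have "(n + 1) * t \<le> k * t" by (intro mult_le_mono1) simp
      then show ?thesis using power_low[of i k] that by simp
    qed (simp add: g_0)
  qed
  have lead: "delta2 q f $ (t + 2 * q) = [:of_nat t / of_nat q * (of_nat t / of_nat q + 1) * c:]"
    by (subst delta2_nth_leading[OF low q]) (simp_all add: c second_order_op_def pderiv_pCons)
  have lead_power: "f ^ n $ (n * t) = [:c ^ n:]"
    using c by (simp add: t_def poly_const_pow)
  have "t = 2"
  proof (rule ccontr)
    assume "t \<noteq> 2"
    then consider "t = 1" | "t > 2" using \<open>t \<ge> 1\<close> by linarith
    then show False
    proof cases
      case 1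
      \<comment> \<open>For t = 1 the power f^n stands alone at w^n: the linear side starts at
        w^(1+2q), and G no earlier than w^(n+1).\<close>
      have "n < t + 2 * q" using 1 n q by simp
      then have "delta2 q f $ n = 0" using delta2_nth_eq_0[of t f n q] low by simp
      then show False
        using eq lead_power G_low[of n] 1 \<open>c \<noteq> 0\<close> by simp
    next
      case 2
      \<comment> \<open>For t > 2 the linear side starts first, with coefficient s(s+1) c for s =
        t/q > 0, and nothing cancels it.\<close>
      have less: "t + 2 * q < n * t" using 2 q by (simp add: n algebra_simps)
      then have "t + 2 * q < (n + 1) * t" by simp
      then have "of_nat t / of_nat q * (of_nat t / of_nat q + 1) * c = 0"
        using eq lead power_low[OF less] G_low[of "t + 2 * q"] by simp
      then have "of_nat t / of_nat q + 1 = (0 :: complex)" using 2 q \<open>c \<noteq> 0\<close> by simp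
      then have "of_nat (t + q) = (0 :: complex)" using q by (simp add: field_simps)
      then show False using 2 by (simp only: of_nat_eq_0_iff)
    qed
  qed
  then show "f $ 1 = 0" using low by simp
  have "2 + 2 * q = n * 2" using n by simp
  then have "[:2 / of_nat q * (2 / of_nat q + 1) * c:] = - [:c ^ n:]"
    using eq lead lead_power G_low[of "n * 2"] \<open>t = 2\<close> by simp
  then have "2 / of_nat q * (2 / of_nat q + 1) * c = - (c ^ q) * c" by (simp add: n)
  then have "2 / of_nat q * (2 / of_nat q + 1) = - (c ^ q)"
    using mult_right_cancel[OF \<open>c \<noteq> 0\<close>] by blast
  then have "c ^ q = - (2 / of_nat q * (2 / of_nat q + 1))" by simp
  then show "\<exists>c. f $ 2 = [:c:] \<and> c ^ q = - (2 / of_nat q * (2 / of_nat q + 1))"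
    using c \<open>t = 2\<close> by blast
qed

text \<open>The zero series also solves (P) and lies in the power series space, so the
  classification for even n asks that the solution be nonzero at some parameter. One parameter is
  enough, because the leading coefficient is analytic with finitely many possible values.\<close>

theorem proposition3p2:
  fixes n :: nat and r \<rho> \<mu>0 :: real
    and GP GT :: "complex \<times> complex \<Rightarrow> complex"
    and gP gT :: "nat \<Rightarrow> complex \<Rightarrow> complex"
  assumes "n \<ge> 2"
    and "r = 2 / (real n - 1)"
    and "\<rho> > 0" and "\<mu>0 > 0"
    and "nonlinearity (n + 1) \<rho> \<mu>0 GP gP"
    and "nonlinearity n \<rho> \<mu>0 GT gT"
  shows
    "(even n \<longrightarrow>
       (\<forall>c0. c0 ^ (n - 1) = - complex_of_real (r * (r + 1)) \<longrightarrow>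
          exactly_one \<mu>0 (P_even n \<mu>0 gP c0)) \<and>
       (\<forall>b. exp b = complex_of_real (- 2 / (real n - 1)) \<longrightarrow>
          exactly_one \<mu>0 (T_even n \<mu>0 gT b)) \<and>
       (\<forall>\<phi>\<in>power_space 1 \<mu>0. solves_P n \<mu>0 gP \<phi> \<and> (\<exists>\<mu>\<in>ball 0 \<mu>0. \<phi> \<mu> \<noteq> 0) \<longrightarrow>
          (\<exists>c0. c0 ^ (n - 1) = - complex_of_real (r * (r + 1)) \<and>
             (\<exists>\<psi>\<in>P_even n \<mu>0 gP c0. translate_of n \<mu>0 \<phi> \<psi>))) \<and>
       (\<forall>b \<phi>. exp b = complex_of_real (- 2 / (real n - 1)) \<and>
            (\<lambda>\<mu>. \<phi> \<mu> - phi0 n b) \<in> power_space 1 \<mu>0 \<and> solves_T n b \<mu>0 gT \<phi> \<longrightarrow>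
          (\<exists>\<psi>\<in>T_even n \<mu>0 gT b. translate_of n \<mu>0 \<phi> \<psi>)))
     \<and>
     (\<forall>m\<ge>2. n = 2 * m - 1 \<longrightarrow>
       (\<forall>c0. c0 ^ (n - 1) = - complex_of_real (r * (r + 1)) \<longrightarrow>
          exactly_one \<mu>0 (P_odd n m \<mu>0 gP c0)) \<and>
       (\<forall>b. exp b = complex_of_real (- 2 / (real n - 1)) \<longrightarrow>
          exactly_one \<mu>0 (T_odd n m \<mu>0 gT b)) \<and>
       (\<forall>\<phi>\<in>log_space (\<lambda>k. (k - 1) div (m - 1)) \<mu>0. solves_P n \<mu>0 gP \<phi> \<and>
            (\<forall>\<mu>\<in>ball 0 \<mu>0. zcoeff \<phi> 0 0 \<mu> ^ (n - 1) = - complex_of_real (r * (r + 1))) \<longrightarrow>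
          (\<exists>c0. c0 ^ (n - 1) = - complex_of_real (r * (r + 1)) \<and>
             (\<exists>\<psi>\<in>P_odd n m \<mu>0 gP c0. translate_of n \<mu>0 \<phi> \<psi>))) \<and>
       (\<forall>b \<phi>. exp b = complex_of_real (- 2 / (real n - 1)) \<and>
            (\<lambda>\<mu>. \<phi> \<mu> - phi0 n b) \<in> log_space (\<lambda>k. k div (m - 1)) \<mu>0 \<and>
            solves_T n b \<mu>0 gT \<phi> \<longrightarrow>
          (\<exists>\<psi>\<in>T_odd n m \<mu>0 gT b. translate_of n \<mu>0 \<phi> \<psi>)))"
proof -
  define q where "q = n - 1"
  have n: "n = q + 1" and q: "q \<ge> 1" using assms(1) by (auto simp: q_def)
  have r: "- complex_of_real (r * (r + 1)) = - (2 / of_nat q * (2 / of_nat q + 1))"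
    by (simp add: assms(2) n)
  have gP: "gP k analytic_on ball 0 \<mu>0" "k < n + 1 \<Longrightarrow> \<mu> \<in> ball 0 \<mu>0 \<Longrightarrow> gP k \<mu> = 0" for k \<mu>
    using nonlinearity_coeff_analytic[OF assms(5,3)] assms(5) by (auto simp: nonlinearity_def)
  have gT: "gT k analytic_on ball 0 \<mu>0" "k < n \<Longrightarrow> \<mu> \<in> ball 0 \<mu>0 \<Longrightarrow> gT k \<mu> = 0" for k \<mu>
    using nonlinearity_coeff_analytic[OF assms(6,3)] assms(6) by (auto simp: nonlinearity_def)
  have P: "inner_P n q c0 \<mu>0 gP" if "c0 ^ (n - 1) = - complex_of_real (r * (r + 1))" for c0
    using that gP q unfolding r q_def[symmetric] by unfold_locales (auto simp: n)
  have T: "inner_T n q b \<mu>0 gT" if "exp b = complex_of_real (- 2 / (real n - 1))" for b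
    using that gT q by unfold_locales (auto simp: n)
  have roots: "finite {z. z ^ (n - 1) = - complex_of_real (r * (r + 1))}"
    using assms(1) by (intro finite_nth_roots) simp
  show ?thesis
  proof (intro conjI impI allI ballI; (elim conjE)?)
    fix c0 assume par: "even n" and root: "c0 ^ (n - 1) = - complex_of_real (r * (r + 1))"
    interpret P: inner_P n q c0 \<mu>0 gP by (rule P[OF root])
    show "exactly_one \<mu>0 (P_even n \<mu>0 gP c0)"
      by (rule P.exactly_one_normalised_solution)
        (erule P.P_even_normalised[OF par], erule (1) P.normalised_in_P_even[OF par])
  next
    fix b assume par: "even n" and root: "exp b = complex_of_real (- 2 / (real n - 1))"
    interpret T: inner_T n q b \<mu>0 gT by (rule T[OF root])
    show "exactly_one \<mu>0 (T_even n \<mu>0 gT b)"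
      by (rule T.exactly_one_normalised_solution)
        (erule T.T_even_normalised[OF par], erule (1) T.normalised_in_T_even[OF par])
  next
    fix \<phi> assume "even n" and sp: "\<phi> \<in> power_space 1 \<mu>0" and sol: "solves_P n \<mu>0 gP \<phi>"
      and "\<exists>\<mu>\<in>ball 0 \<mu>0. \<phi> \<mu> \<noteq> 0"
    then obtain \<nu> where \<nu>: "\<nu> \<in> ball 0 \<mu>0" "\<phi> \<nu> \<noteq> 0" by blast
    have lead: "\<phi> \<mu> $ 1 = 0"
      "\<exists>c. \<phi> \<mu> $ 2 = [:c:] \<and> c ^ (n - 1) = - complex_of_real (r * (r + 1))"
      if "\<mu> \<in> ball 0 \<mu>0" "\<phi> \<mu> \<noteq> 0" for \<mu>
    proof -
      have "delta2 q (\<phi> \<mu>) = - (\<phi> \<mu> ^ n) + subst_G gP \<mu> (\<phi> \<mu>)"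
        using sol that(1) by (simp add: solves_P_def q_def)
      note * = solution_P_leading_coeff[where f = "\<phi> \<mu>" and g = gP and \<mu> = \<mu>, OF n q
        gP(2)[OF _ that(1)] power_spaceD(1)[OF sp that(1)] that(2) power_spaceD(2)[OF sp that(1)] this]
      show "\<phi> \<mu> $ 1 = 0" by (rule *(1))
      show "\<exists>c. \<phi> \<mu> $ 2 = [:c:] \<and> c ^ (n - 1) = - complex_of_real (r * (r + 1))"
        using *(2) unfolding r q_def[symmetric] .
    qed
    \<comment> \<open>The value 0 covers parameters at which the solution vanishes. Constancy then
      carries the root found at \<open>\<nu>\<close> to the whole disc, and since it is nonzero, the
      solution vanishes at no parameter.\<close>
    have "coeff (\<phi> \<mu> $ 2) 0 \<in> insert 0 {z. z ^ (n - 1) = - complex_of_real (r * (r + 1))}"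
      if "\<mu> \<in> ball 0 \<mu>0" for \<mu>
      using lead(2)[OF that] by (cases "\<phi> \<mu> = 0") auto
    then obtain c0 where c0: "\<And>\<mu>. \<mu> \<in> ball 0 \<mu>0 \<Longrightarrow> coeff (\<phi> \<mu> $ 2) 0 = c0"
      using analytic_finite_range_constant[OF power_spaceD(4)[OF sp, of 2 0]] roots finite_insert by metis
    have root: "c0 ^ (n - 1) = - complex_of_real (r * (r + 1))"
      using lead(2)[OF \<nu>] c0[OF \<nu>(1)] by auto
    interpret P: inner_P n q c0 \<mu>0 gP by (rule P[OF root])
    have norm: "P.normalised_at (\<phi> \<mu>)" if "\<mu> \<in> ball 0 \<mu>0" for \<mu>
    proof -
      have "\<phi> \<mu> \<noteq> 0" using c0[OF that] P.c0_nonzero by auto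
      then show ?thesis
        using lead[OF that] c0[OF that] power_spaceD(1)[OF sp that] by (auto simp: P.normalised_at_def)
    qed
    have "\<exists>\<psi>\<in>P_even n \<mu>0 gP c0. translate_of n \<mu>0 \<phi> \<psi>"
      by (rule P.translate_of_normalised_solution[OF _ _ sol power_spaceD(4)[OF sp]])
        (erule (1) P.normalised_in_P_even[OF \<open>even n\<close>], erule norm)
    with root show "\<exists>c0. c0 ^ (n - 1) = - complex_of_real (r * (r + 1)) \<and>
        (\<exists>\<psi>\<in>P_even n \<mu>0 gP c0. translate_of n \<mu>0 \<phi> \<psi>)" by blast
  next
    fix b \<phi> assume "even n" and b: "exp b = complex_of_real (- 2 / (real n - 1))"
      and sp: "(\<lambda>\<mu>. \<phi> \<mu> - phi0 n b) \<in> power_space 1 \<mu>0" and sol: "solves_T n b \<mu>0 gT \<phi>"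
    interpret T: inner_T n q b \<mu>0 gT by (rule T[OF b])
    show "\<exists>\<psi>\<in>T_even n \<mu>0 gT b. translate_of n \<mu>0 \<phi> \<psi>"
      by (rule T.translate_of_normalised_solution[OF _ _ sol power_spaceD(4)[OF sp]])
        (erule (1) T.normalised_in_T_even[OF \<open>even n\<close>], erule power_spaceD(1)[OF sp])
  next
    fix m c0 assume par: "2 \<le> m" "n = 2 * m - 1" and root: "c0 ^ (n - 1) = - complex_of_real (r * (r + 1))"
    interpret P: inner_P n q c0 \<mu>0 gP by (rule P[OF root])
    show "exactly_one \<mu>0 (P_odd n m \<mu>0 gP c0)"
      by (rule P.exactly_one_normalised_solution)
        (erule P.P_odd_normalised[OF par], erule (1) P.normalised_in_P_odd[OF par])
  next
    fix m b assume par: "2 \<le> m" "n = 2 * m - 1" and root: "exp b = complex_of_real (- 2 / (real n - 1))"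
    interpret T: inner_T n q b \<mu>0 gT by (rule T[OF root])
    show "exactly_one \<mu>0 (T_odd n m \<mu>0 gT b)"
      by (rule T.exactly_one_normalised_solution)
        (erule T.T_odd_normalised[OF par], erule (1) T.normalised_in_T_odd[OF par])
  next
    fix m \<phi> assume m: "2 \<le> m" "n = 2 * m - 1"
      and sp: "\<phi> \<in> log_space (\<lambda>k. (k - 1) div (m - 1)) \<mu>0" and sol: "solves_P n \<mu>0 gP \<phi>"
      and lead: "\<forall>\<mu>\<in>ball 0 \<mu>0. zcoeff \<phi> 0 0 \<mu> ^ (n - 1) = - complex_of_real (r * (r + 1))"
    have an: "zcoeff \<phi> 0 0 analytic_on ball 0 \<mu>0"
      unfolding zcoeff_def by (rule log_spaceD(4)[OF sp])
    obtain c0 where c0: "\<And>\<mu>. \<mu> \<in> ball 0 \<mu>0 \<Longrightarrow> zcoeff \<phi> 0 0 \<mu> = c0"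
      using analytic_finite_range_constant[OF an _ roots] lead by blast
    have root: "c0 ^ (n - 1) = - complex_of_real (r * (r + 1))"
      using lead c0[of 0] assms(4) by force
    interpret P: inner_P n q c0 \<mu>0 gP by (rule P[OF root])
    have "\<exists>\<psi>\<in>P_odd n m \<mu>0 gP c0. translate_of n \<mu>0 \<phi> \<psi>"
      by (rule P.translate_of_normalised_solution[OF _ _ sol log_spaceD(4)[OF sp]])
        (erule (1) P.normalised_in_P_odd[OF m], rule P.normalised_at_log_space[OF m(1) sp _ c0])
    with root show "\<exists>c0. c0 ^ (n - 1) = - complex_of_real (r * (r + 1)) \<and>
        (\<exists>\<psi>\<in>P_odd n m \<mu>0 gP c0. translate_of n \<mu>0 \<phi> \<psi>)" by blast
  next
    fix m b \<phi> assume m: "2 \<le> m" "n = 2 * m - 1" and b: "exp b = complex_of_real (- 2 / (real n - 1))"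
      and sp: "(\<lambda>\<mu>. \<phi> \<mu> - phi0 n b) \<in> log_space (\<lambda>k. k div (m - 1)) \<mu>0"
      and sol: "solves_T n b \<mu>0 gT \<phi>"
    interpret T: inner_T n q b \<mu>0 gT by (rule T[OF b])
    show "\<exists>\<psi>\<in>T_odd n m \<mu>0 gT b. translate_of n \<mu>0 \<phi> \<psi>"
      by (rule T.translate_of_normalised_solution[OF _ _ sol log_spaceD(4)[OF sp]])
        (erule (1) T.normalised_in_T_odd[OF m], erule log_spaceD(1)[OF sp])
  qed
qed

end
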